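(* For all $\gamma,K>0$ and $\delta\in(0,1)$ there exists $\epsilon>0$ such that the following holds. Let $p=p(n)$ and $q=q(n)$ be positive reals such that (i) $p\le 1-\delta$, (ii) $q\le n^{-\gamma}$, and (iii) $pqn\le \epsilon\log n$. Let $G_1$ be a (fixed, i.e. non-random) graph of order $n$ with maximal degree at most $qn$, and let $G_2\in\mathcal G(n,p)$. Then with failure probability $O(n^{-K})$ there is a packing of $G_1$ and $G_2$; that is, the probability that $G_1$ and $G_2$ cannot be packed is $O(n^{-K})$ as $n\to\infty$.
   Context: Graphs are finite and simple; the order of a graph is its number of vertices. $\mathcal G(n,p)$ denotes the random graph on $n$ vertices in which each of the $\binom n2$ possible edges is present independently with probability $p$. Two graphs $G_1,G_2$ of order $n$ can be packed (there is a packing of $G_1$ and $G_2$) if they can be placed onto the same vertex set so that their edge sets are disjoint; equivalently, there is a bijection $\phi:V(G_1)\to V(G_2)$ such that no edge of $G_1$ is mapped by $\phi$ to an edge of $G_2$. $\log$ is the natural logarithm. Here $p,q$ are functions of the integer $n\ge 2$, the conditions are required for every such $n$, and $G_1=G_1(n)$ is given for each $n$. *)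

theory Defs
  imports "HOL-Probability.Probability" "HOL-Library.Landau_Symbols"
begin

text \<open>A graph is a pair of its vertex set and its edge set; an edge is a set of two vertices.\<close>

type_synonym 'a ugraph = "'a set \<times> 'a set set"

abbreviation verts :: "'a ugraph \<Rightarrow> 'a set" where
  "verts G \<equiv> fst G"

abbreviation edges :: "'a ugraph \<Rightarrow> 'a set set" where
  "edges G \<equiv> snd G"

definition all_edges :: "'a set \<Rightarrow> 'a set set" where
  "all_edges V = {e. e \<subseteq> V \<and> card e = 2}"

definition simple_graph :: "'a ugraph \<Rightarrow> bool" where
  "simple_graph G \<longleftrightarrow> finite (verts G) \<and> edges G \<subseteq> all_edges (verts G)"

definition graph_order :: "'a ugraph \<Rightarrow> nat" where
  "graph_order G = card (verts G)"

definition degree :: "'a ugraph \<Rightarrow> 'a \<Rightarrow> nat" where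
  "degree G v = card {e \<in> edges G. v \<in> e}"

text \<open>Only meaningful for graphs with a nonempty finite vertex set.\<close>

definition max_degree :: "'a ugraph \<Rightarrow> nat" where
  "max_degree G = Max (degree G ` verts G)"

definition is_packing :: "('a \<Rightarrow> 'b) \<Rightarrow> 'a ugraph \<Rightarrow> 'b ugraph \<Rightarrow> bool" where
  "is_packing \<phi> G H \<longleftrightarrow>
     bij_betw \<phi> (verts G) (verts H) \<and> (\<forall>e \<in> edges G. \<phi> ` e \<notin> edges H)"

definition can_be_packed :: "'a ugraph \<Rightarrow> 'b ugraph \<Rightarrow> bool" where
  "can_be_packed G H \<longleftrightarrow> (\<exists>\<phi>. is_packing \<phi> G H)"

text \<open>
  The binomial random graph on the vertex set \<open>{..<n}\<close>: an independent coin is tossed for each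
  possible edge. It is the intended distribution for \<open>0 \<le> p \<le> 1\<close>, as \<open>bernoulli_pmf\<close> clamps its
  parameter to this interval.
\<close>

definition random_graph :: "nat \<Rightarrow> real \<Rightarrow> nat ugraph pmf" where
  "random_graph n p =
     map_pmf (\<lambda>f. ({..<n}, {e \<in> all_edges {..<n}. f e}))
       (Pi_pmf (all_edges {..<n}) False (\<lambda>_. bernoulli_pmf p))"

end

theory Submission
  imports Defs "HOL-Real_Asymp.Real_Asymp"
begin

text \<open>
  The vertices of the fixed graph are split into classes \<open>A\<^sub>1, A\<^sub>2, \<dots>\<close> of polynomial size
  \<open>m \<approx> n powr (g / 8)\<close>, where \<open>g = min \<gamma> 1\<close>, and \<open>{..<n}\<close> is split into target classes of the same
  sizes. The classes are embedded one after another, each onto its own target. When \<open>A\<close> is embedded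
  onto \<open>B\<close>, a vertex \<open>v \<in> A\<close> may go to \<open>w \<in> B\<close> if no edge of the random graph joins \<open>w\<close> to the image
  of an already embedded neighbour of \<open>v\<close>. If every \<open>A\<close> is independent, the only condition left is
  that the chosen pairs form a perfect matching; and as the targets are fixed in advance, the
  coins that decide which pairs are allowed have not been looked at in any earlier round.

  A pair is allowed with probability at least \<open>(1 - p) ^ \<Delta>\<close>, \<open>\<Delta>\<close> being the maximum degree. Since
  \<open>p \<Delta> \<le> \<epsilon> ln n\<close> and \<open>p\<close> is bounded away from 1, this is at least \<open>n powr (- \<epsilon> / \<delta>)\<close>, which
  for small \<open>\<epsilon>\<close> is far more than \<open>1 / m\<close>. Were the pairs independent, the random bipartite graph
  between \<open>A\<close> and \<open>B\<close> would have a perfect matching except with a probability that is smaller than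
  any power of \<open>n\<close>. They are not independent: the pairs \<open>(v, w)\<close> and \<open>(v', w)\<close> share a coin for
  each common neighbour of \<open>v\<close> and \<open>v'\<close>. But if each vertex has at most a constant number \<open>k\<close> of
  neighbours in \<open>A\<close>, each coin affects at most \<open>k\<close> pairs, and a product inequality of
  Finner type (\<open>prob_all_hit_le\<close>) bounds the probability that many pairs fail by the
  \<open>k\<close>-th root of its value under independence:
  a rectangle \<open>S \<times> T\<close> contains no allowed pair with probability at most
  \<open>exp (- (1 - p) ^ \<Delta> * |S| * |T| / k)\<close>. Hall's theorem and a union bound over rectangles
  (\<open>prob_no_perfect_matching_le\<close>) then give the matching, and an induction over the classes
  (\<open>prob_no_partial_packing_le\<close>) gives the packing.

  That there is a partition into independent classes in which all vertices have boundedly many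
  neighbours (\<open>ex_spread_partition\<close>) is where \<open>\<Delta> \<le> n powr (1 - g)\<close> enters. Vertices are added to
  a class one at a time so that the potential \<open>\<Sum>u. b ^ d u\<close> stays small, where \<open>d u\<close> is the number
  of neighbours of \<open>u\<close> in the class and \<open>b\<close> is a small power of \<open>n\<close>: on average over the candidates
  a step changes it by a factor close to 1. A potential of at most \<open>n\<^sup>2\<close> forces
  \<open>d u \<le> 16 / g\<close> when \<open>b = n powr (g / 8)\<close>.
\<close>

section \<open>A product inequality for hitting sets\<close>

text \<open>
  The inequality of arithmetic and geometric means for \<open>k\<close> numbers, of which those not listed are 1.
\<close>

lemma prod_powr_le_padded_mean:
  fixes x :: "'j \<Rightarrow> real"
  assumes "finite J" "card J \<le> k" "k > 0" "\<And>j. j \<in> J \<Longrightarrow> x j \<ge> 0"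
  shows "(\<Prod>j\<in>J. x j) powr (1 / k) \<le> ((\<Sum>j\<in>J. x j) + (k - card J)) / k"
proof -
  define S where "S = J <+> {..<k - card J}"
  define y where "y = (case_sum x (\<lambda>_. 1) :: 'j + nat \<Rightarrow> real)"
  have S: "finite S" "card S = k"
    using assms by (auto simp: S_def card_Plus)
  with assms have "S \<noteq> {}" by auto
  have y: "y i \<ge> 0" if "i \<in> S" for i
    using that assms by (auto simp: S_def y_def)
  have 1: "(\<Prod>i\<in>S. y i) = (\<Prod>j\<in>J. x j)"
    unfolding S_def y_def using assms by (simp add: prod.Plus)
  have 2: "(\<Sum>i\<in>S. y i / card S) = ((\<Sum>j\<in>J. x j) + (k - card J)) / k"
    unfolding sum_divide_distrib[symmetric] S(2) unfolding S_def y_def using assms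
    by (simp add: sum.Plus)
  show ?thesis
    using arith_geom_mean[of S y, OF S(1) \<open>S \<noteq> {}\<close> y] unfolding 1 2 unfolding S(2) .
qed

text \<open>
  Hoelder's inequality on a space with two points of weights \<open>p\<close> and \<open>1 - p\<close>, for functions
  with \<open>k\<close>-th powers 1 at the first point and \<open>b j\<close> at the second. Dividing by the right-hand side
  reduces it to the previous lemma at each of the two points, and the weighted means of the
  two bounds add up to 1.
\<close>

lemma two_point_Hoelder:
  fixes b :: "'j \<Rightarrow> real"
  assumes "finite J" "card J \<le> k" "k > 0" "\<And>j. j \<in> J \<Longrightarrow> b j \<ge> 0" "0 < p" "p \<le> 1"
  shows "p + (1 - p) * (\<Prod>j\<in>J. b j) powr (1 / k) \<le> (\<Prod>j\<in>J. p + (1 - p) * b j) powr (1 / k)"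
proof -
  define c where "c j = p + (1 - p) * b j" for j
  have c: "c j > 0" if "j \<in> J" for j
    unfolding c_def using that assms by (intro add_pos_nonneg) auto
  define C where "C = (\<Prod>j\<in>J. c j) powr (1 / k)"
  have "(\<Prod>j\<in>J. c j) > 0" using c by (intro prod_pos) auto
  hence C: "C > 0" by (simp add: C_def)
  have 1: "1 / C \<le> ((\<Sum>j\<in>J. 1 / c j) + (k - card J)) / k"
    using prod_powr_le_padded_mean[OF assms(1-3), of "\<lambda>j. 1 / c j"] c
    by (simp add: prod_dividef C_def powr_divide prod_nonneg less_imp_le)
  have 2: "(\<Prod>j\<in>J. b j) powr (1 / k) / C \<le> ((\<Sum>j\<in>J. b j / c j) + (k - card J)) / k"
    using prod_powr_le_padded_mean[OF assms(1-3), of "\<lambda>j. b j / c j"] c assms(4)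
    by (simp add: prod_dividef C_def powr_divide prod_nonneg less_imp_le)
  have "p * (1 / C) + (1 - p) * ((\<Prod>j\<in>J. b j) powr (1 / k) / C)
      \<le> p * (((\<Sum>j\<in>J. 1 / c j) + (k - card J)) / k) + (1 - p) * (((\<Sum>j\<in>J. b j / c j) + (k - card J)) / k)"
    using assms by (intro add_mono mult_left_mono 1 2) auto
  also have "\<dots> = (p * (\<Sum>j\<in>J. 1 / c j) + (1 - p) * (\<Sum>j\<in>J. b j / c j) + (k - card J)) / k"
    using assms(3) by (simp add: field_simps)
  also have "p * (\<Sum>j\<in>J. 1 / c j) + (1 - p) * (\<Sum>j\<in>J. b j / c j) = (\<Sum>j\<in>J. c j / c j)"
    unfolding sum_distrib_left sum.distrib[symmetric] c_def
    by (intro sum.cong refl) (simp only: add_divide_distrib times_divide_eq_right mult_1_right)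
  also have "\<dots> = (\<Sum>j\<in>J. 1)"
    using c by (intro sum.cong refl) (metis divide_self less_irrefl)
  also have "((\<Sum>j\<in>J. 1) + real (k - card J)) / k = 1"
    using assms by (simp add: of_nat_diff)
  finally have "(p + (1 - p) * (\<Prod>j\<in>J. b j) powr (1 / k)) / C \<le> 1"
    by (simp add: add_divide_distrib)
  thus ?thesis using C by (simp add: C_def c_def)
qed

lemma prob_bind_pmf:
  "measure_pmf.prob (bind_pmf M N) X = measure_pmf.expectation M (\<lambda>x. measure_pmf.prob (N x) X)"
proof -
  have "ennreal (measure_pmf.prob (bind_pmf M N) X) = (\<integral>\<^sup>+x. emeasure (N x) X \<partial>M)"
    by (simp only: measure_pmf.emeasure_eq_measure[symmetric] emeasure_bind_pmf)
  also have "\<dots> = (\<integral>\<^sup>+x. ennreal (measure_pmf.prob (N x) X) \<partial>M)"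
    by (simp only: measure_pmf.emeasure_eq_measure)
  also have "\<dots> = ennreal (measure_pmf.expectation M (\<lambda>x. measure_pmf.prob (N x) X))"
    by (intro nn_integral_eq_integral measure_pmf.integrable_const_bound[where B = 1]) auto
  finally show ?thesis
    by (simp add: integral_nonneg_AE)
qed

lemma prob_Pi_bernoulli_insert:
  assumes "finite I" "x \<notin> I" "0 \<le> p" "p \<le> 1"
  shows "measure_pmf.prob (Pi_pmf (insert x I) False (\<lambda>_. bernoulli_pmf p)) X =
    p * measure_pmf.prob (Pi_pmf I False (\<lambda>_. bernoulli_pmf p)) {f. f(x := True) \<in> X} +
    (1 - p) * measure_pmf.prob (Pi_pmf I False (\<lambda>_. bernoulli_pmf p)) {f. f(x := False) \<in> X}"
  unfolding Pi_pmf_insert'[OF assms(1,2)] map_pmf_def[symmetric] prob_bind_pmf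
  using assms by (simp add: vimage_def)

text \<open>
  A special case of Finner's inequality: if each coin lies in at most \<open>k\<close> of the sets \<open>N j\<close>, then
  the probability that every set contains a successful coin is at most the \<open>k\<close>-th root of what it
  would be for disjoint sets. In the induction one coin \<open>x\<close> is revealed: a success
  settles all sets containing \<open>x\<close>, a failure removes \<open>x\<close> from them, and
  \<open>two_point_Hoelder\<close> recombines the two cases for the at most \<open>k\<close> sets concerned.
\<close>

lemma prob_all_hit_le:
  fixes N :: "'j \<Rightarrow> 'i set"
  assumes "finite I" "finite J" "k > 0" "0 < p" "p \<le> 1"
    and "\<And>j. j \<in> J \<Longrightarrow> N j \<subseteq> I"
    and "\<And>x. x \<in> I \<Longrightarrow> card {j \<in> J. x \<in> N j} \<le> k"
  shows "measure_pmf.prob (Pi_pmf I False (\<lambda>_. bernoulli_pmf p)) {f. \<forall>j\<in>J. \<exists>x\<in>N j. f x}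
    \<le> (\<Prod>j\<in>J. 1 - (1 - p) ^ card (N j)) powr (1 / k)"
  using assms(1,2,6,7)
proof (induction I arbitrary: J N rule: finite_induct)
  case empty
  show ?case
  proof (cases "J = {}")
    case False
    then obtain j where "j \<in> J" by auto
    moreover have "N j = {}" using empty \<open>j \<in> J\<close> by auto
    ultimately have e: "{f. \<forall>j\<in>J. \<exists>x\<in>N j. f x} = {}" by auto
    show ?thesis unfolding e by simp
  qed auto
next
  case (insert x I)
  define P where "P = measure_pmf.prob (Pi_pmf I False (\<lambda>_. bernoulli_pmf p))"
  define g where "g d = 1 - (1 - p) ^ d" for d
  have g0: "g d \<ge> 0" for d using assms(4,5) by (simp add: g_def power_le_one)
  define J1 where "J1 = {j \<in> J. x \<in> N j}"
  define J0 where "J0 = {j \<in> J. x \<notin> N j}"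
  have J: "J = J1 \<union> J0" "J1 \<inter> J0 = {}" "finite J0" "finite J1"
    using insert.prems(1) by (auto simp: J1_def J0_def)
  have fN: "finite (N j)" if "j \<in> J" for j
    using insert.prems(2)[OF that] insert.hyps(1) finite_subset by blast
  have 1: "P {f. \<forall>j\<in>J. \<exists>y\<in>N j. (f(x := True)) y} \<le> (\<Prod>j\<in>J0. g (card (N j))) powr (1 / k)"
  proof -
    have "{f. \<forall>j\<in>J. \<exists>y\<in>N j. (f(x := True)) y} = {f. \<forall>j\<in>J0. \<exists>y\<in>N j. f y}"
      unfolding J0_def fun_upd_apply by (intro Collect_cong) (smt (verit) mem_Collect_eq)
    moreover have "P {f. \<forall>j\<in>J0. \<exists>y\<in>N j. f y} \<le> (\<Prod>j\<in>J0. g (card (N j))) powr (1 / k)"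
      unfolding P_def g_def
    proof (rule insert.IH)
      fix y assume "y \<in> I"
      have "card {j \<in> J0. y \<in> N j} \<le> card {j \<in> J. y \<in> N j}"
        using insert.prems(1) by (intro card_mono) (auto simp: J0_def)
      thus "card {j \<in> J0. y \<in> N j} \<le> k" using insert.prems(3)[of y] \<open>y \<in> I\<close> by simp
    qed (use J(3) insert.prems in \<open>auto simp: J0_def\<close>)
    ultimately show ?thesis by simp
  qed
  have 2: "P {f. \<forall>j\<in>J. \<exists>y\<in>N j. (f(x := False)) y} \<le> (\<Prod>j\<in>J. g (card (N j - {x}))) powr (1 / k)"
  proof -
    have "{f. \<forall>j\<in>J. \<exists>y\<in>N j. (f(x := False)) y} = {f. \<forall>j\<in>J. \<exists>y\<in>N j - {x}. f y}"
      by (intro Collect_cong ball_cong refl) (auto simp: fun_upd_apply)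
    moreover have "P {f. \<forall>j\<in>J. \<exists>y\<in>N j - {x}. f y} \<le> (\<Prod>j\<in>J. g (card (N j - {x}))) powr (1 / k)"
      unfolding P_def g_def
    proof (rule insert.IH)
      fix y assume "y \<in> I"
      have "card {j \<in> J. y \<in> N j - {x}} \<le> card {j \<in> J. y \<in> N j}"
        using insert.prems(1) by (intro card_mono) auto
      thus "card {j \<in> J. y \<in> N j - {x}} \<le> k" using insert.prems(3)[of y] \<open>y \<in> I\<close> by simp
    qed (use insert.prems in auto)
    ultimately show ?thesis by simp
  qed
  define A where "A = (\<Prod>j\<in>J0. g (card (N j))) powr (1 / k)"
  have A: "A \<ge> 0" by (simp add: A_def)
  have "(\<Prod>j\<in>J. g (card (N j - {x}))) = (\<Prod>j\<in>J0. g (card (N j))) * (\<Prod>j\<in>J1. g (card (N j - {x})))"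
    unfolding J(1) using J(2-4) by (subst prod.union_disjoint) (auto simp: J0_def mult.commute)
  hence 3: "(\<Prod>j\<in>J. g (card (N j - {x}))) powr (1 / k) = A * (\<Prod>j\<in>J1. g (card (N j - {x}))) powr (1 / k)"
    using g0 by (simp add: A_def powr_mult prod_nonneg)
  have "measure_pmf.prob (Pi_pmf (insert x I) False (\<lambda>_. bernoulli_pmf p)) {f. \<forall>j\<in>J. \<exists>x\<in>N j. f x}
      = p * P {f. \<forall>j\<in>J. \<exists>y\<in>N j. (f(x := True)) y} + (1 - p) * P {f. \<forall>j\<in>J. \<exists>y\<in>N j. (f(x := False)) y}"
    using insert.hyps assms(4,5) by (subst prob_Pi_bernoulli_insert) (auto simp: P_def)
  also have "\<dots> \<le> p * A + (1 - p) * (A * (\<Prod>j\<in>J1. g (card (N j - {x}))) powr (1 / k))"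
    using 1 2 assms(4,5) unfolding 3 A_def[symmetric] by (intro add_mono mult_left_mono) auto
  also have "\<dots> = A * (p + (1 - p) * (\<Prod>j\<in>J1. g (card (N j - {x}))) powr (1 / k))"
    by (simp add: algebra_simps)
  also have "\<dots> \<le> A * (\<Prod>j\<in>J1. p + (1 - p) * g (card (N j - {x}))) powr (1 / k)"
    using assms(3-5) g0 J(4) insert.prems(3)[of x] A
    by (intro mult_left_mono two_point_Hoelder) (auto simp: J1_def)
  also have "(\<Prod>j\<in>J1. p + (1 - p) * g (card (N j - {x}))) = (\<Prod>j\<in>J1. g (card (N j)))"
  proof (intro prod.cong refl)
    fix j assume j: "j \<in> J1"
    hence "card (N j) = Suc (card (N j - {x}))"
      by (intro card.remove fN) (auto simp: J1_def)
    thus "p + (1 - p) * g (card (N j - {x})) = g (card (N j))"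
      by (simp add: g_def algebra_simps)
  qed
  also have "A * (\<Prod>j\<in>J1. g (card (N j))) powr (1 / k) = (\<Prod>j\<in>J. g (card (N j))) powr (1 / k)"
    unfolding A_def J(1) using J(2-4) g0
    by (subst prod.union_disjoint) (auto simp: powr_mult prod_nonneg mult.commute)
  finally show ?case by (simp add: g_def)
qed

section \<open>Perfect matchings in random bipartite graphs\<close>

text \<open>
  Hall's theorem, by the argument of Halmos and Vaughan: if some proper nonempty \<open>S\<close> has exactly as
  many neighbours as elements, match \<open>S\<close> first and the rest outside its neighbourhood; otherwise
  there is room to match one vertex arbitrarily.
\<close>

lemma Hall_matching:
  assumes "finite A" "\<And>v. v \<in> A \<Longrightarrow> finite (W v)"
    and "\<And>S. S \<subseteq> A \<Longrightarrow> card S \<le> card (\<Union>(W ` S))"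
  shows "\<exists>\<sigma>. inj_on \<sigma> A \<and> (\<forall>v\<in>A. \<sigma> v \<in> W v)"
  using assms
proof (induction "card A" arbitrary: A W rule: less_induct)
  case less
  have fin: "finite S" "finite (\<Union>(W ` S))" if "S \<subseteq> A" for S
    using that less.prems(1,2) finite_subset by blast+
  consider "A = {}"
    | S where "S \<subseteq> A" "S \<noteq> {}" "S \<noteq> A" "card (\<Union>(W ` S)) \<le> card S"
    | "A \<noteq> {}" "\<And>S. S \<subseteq> A \<Longrightarrow> S \<noteq> {} \<Longrightarrow> S \<noteq> A \<Longrightarrow> card S < card (\<Union>(W ` S))"
    by (metis not_less)
  thus ?case
  proof cases
    case 1
    thus ?thesis by auto
  next
    case (2 S)
    let ?W = "\<lambda>v. W v - \<Union>(W ` S)"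
    have "card S < card A"
      using 2 less.prems(1) by (intro psubset_card_mono) auto
    hence "\<exists>\<sigma>. inj_on \<sigma> S \<and> (\<forall>v\<in>S. \<sigma> v \<in> W v)"
      using 2(1) less.prems by (intro less.hyps fin) auto
    then obtain \<sigma> where \<sigma>: "inj_on \<sigma> S" "\<And>v. v \<in> S \<Longrightarrow> \<sigma> v \<in> W v" by blast
    have "\<exists>\<tau>. inj_on \<tau> (A - S) \<and> (\<forall>v\<in>A - S. \<tau> v \<in> ?W v)"
    proof (intro less.hyps)
      show "card (A - S) < card A"
        using 2 less.prems(1) by (intro psubset_card_mono) auto
    next
      fix R assume R: "R \<subseteq> A - S"
      have "card R + card S = card (R \<union> S)"
        using R 2(1) fin[of R] fin[of S] by (subst card_Un_disjoint) auto
      also have "\<dots> \<le> card (\<Union>(W ` (R \<union> S)))"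
        using R 2(1) by (intro less.prems(3)) auto
      also have "\<Union>(W ` (R \<union> S)) = \<Union>(?W ` R) \<union> \<Union>(W ` S)" by auto
      also have "card \<dots> \<le> card (\<Union>(?W ` R)) + card (\<Union>(W ` S))"
        by (rule card_Un_le)
      finally show "card R \<le> card (\<Union>(?W ` R))" using 2(4) by simp
    qed (use less.prems in auto)
    then obtain \<tau> where \<tau>: "inj_on \<tau> (A - S)" "\<And>v. v \<in> A - S \<Longrightarrow> \<tau> v \<in> ?W v" by blast
    let ?\<rho> = "\<lambda>v. if v \<in> S then \<sigma> v else \<tau> v"
    have "inj_on ?\<rho> A"
    proof (rule inj_onI)
      fix u v assume "u \<in> A" "v \<in> A" "?\<rho> u = ?\<rho> v"
      thus "u = v"
        using \<sigma>(2)[of u] \<sigma>(2)[of v] \<tau>(2)[of u] \<tau>(2)[of v] inj_onD[OF \<sigma>(1), of u v] inj_onD[OF \<tau>(1), of u v]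
        by (auto split: if_splits)
    qed
    moreover have "\<forall>v\<in>A. ?\<rho> v \<in> W v" using \<sigma>(2) \<tau>(2) by auto
    ultimately show ?thesis by blast
  next
    case 3
    then obtain a where a: "a \<in> A" by auto
    have "card {a} \<le> card (\<Union>(W ` {a}))"
      using a by (intro less.prems(3)) auto
    hence "W a \<noteq> {}" by auto
    then obtain x where x: "x \<in> W a" by auto
    let ?W = "\<lambda>v. W v - {x}"
    have "\<exists>\<tau>. inj_on \<tau> (A - {a}) \<and> (\<forall>v\<in>A - {a}. \<tau> v \<in> ?W v)"
    proof (intro less.hyps)
      show "card (A - {a}) < card A"
        using a less.prems(1) by (intro psubset_card_mono) auto
    next
      fix R assume R: "R \<subseteq> A - {a}"
      show "card R \<le> card (\<Union>(?W ` R))"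
      proof (cases "R = {}")
        case False
        hence "card R < card (\<Union>(W ` R))"
          using R a by (intro 3(2)) auto
        also have "\<dots> \<le> card (insert x (\<Union>(?W ` R)))"
          using R fin(2)[of R] by (intro card_mono) (auto intro: finite_subset)
        also have "\<dots> \<le> Suc (card (\<Union>(?W ` R)))"
          by (rule card_insert_le_m1) auto
        finally show ?thesis by simp
      qed auto
    qed (use less.prems in auto)
    then obtain \<tau> where \<tau>: "inj_on \<tau> (A - {a})" "\<And>v. v \<in> A - {a} \<Longrightarrow> \<tau> v \<in> ?W v" by blast
    have "inj_on (\<tau>(a := x)) A"
      using \<tau> by (auto simp: inj_on_def)
    moreover have "\<forall>v\<in>A. (\<tau>(a := x)) v \<in> W v" using \<tau>(2) x by auto
    ultimately show ?thesis by blast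
  qed
qed

text \<open>
  The form of Hall's theorem that suits a union bound: it treats both sides alike, and the two sides
  of the offending rectangle together exceed \<open>card A\<close> by exactly 1.
\<close>

lemma perfect_matching_or_empty_rectangle:
  assumes "finite A" "finite B" "card A = card B"
    and "\<not> (\<exists>\<sigma>. bij_betw \<sigma> A B \<and> (\<forall>v\<in>A. ok v (\<sigma> v)))"
  shows "\<exists>S T. S \<subseteq> A \<and> T \<subseteq> B \<and> card S + card T = card A + 1 \<and> (\<forall>v\<in>S. \<forall>w\<in>T. \<not> ok v w)"
proof -
  define W where "W v = {w \<in> B. ok v w}" for v
  have "\<not> (\<forall>S\<subseteq>A. card S \<le> card (\<Union>(W ` S)))"
  proof
    assume "\<forall>S\<subseteq>A. card S \<le> card (\<Union>(W ` S))"
    hence "\<exists>\<sigma>. inj_on \<sigma> A \<and> (\<forall>v\<in>A. \<sigma> v \<in> W v)"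
      using assms(1,2) by (intro Hall_matching) (auto simp: W_def)
    then obtain \<sigma> where \<sigma>: "inj_on \<sigma> A" "\<forall>v\<in>A. \<sigma> v \<in> W v" by blast
    hence "\<sigma> ` A = B"
      using assms(2,3) by (intro card_subset_eq) (auto simp: W_def card_image)
    hence "bij_betw \<sigma> A B" using \<sigma>(1) by (simp add: bij_betw_def)
    thus False using assms(4) \<sigma>(2) by (auto simp: W_def)
  qed
  then obtain S where S: "S \<subseteq> A" "card (\<Union>(W ` S)) < card S" by (auto simp: not_le)
  have "card S \<le> card A" using S assms(1) by (intro card_mono) auto
  have "card (B - \<Union>(W ` S)) = card B - card (\<Union>(W ` S))"
    using assms(2) by (intro card_Diff_subset) (auto simp: W_def intro: finite_subset)
  hence "card A + 1 - card S \<le> card (B - \<Union>(W ` S))"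
    using S(2) assms(3) by linarith
  then obtain T where T: "T \<subseteq> B - \<Union>(W ` S)" "card T = card A + 1 - card S"
    by (metis obtain_subset_with_card_n)
  hence "card S + card T = card A + 1" using \<open>card S \<le> card A\<close> by simp
  moreover have "\<forall>v\<in>S. \<forall>w\<in>T. \<not> ok v w" using T(1) by (auto simp: W_def)
  ultimately show ?thesis using S(1) T(1) by blast
qed

lemma binomial_product_le:
  assumes "1 \<le> s" "s \<le> m"
  shows "(m choose s) * (m choose (m + 1 - s)) \<le> (m ^ 2) ^ s"
proof -
  have "m choose (m + 1 - s) = m choose (s - 1)"
    using assms by (subst binomial_symmetric) auto
  also have "\<dots> \<le> m ^ (s - 1)" using assms by (intro binomial_le_pow) auto
  also have "\<dots> \<le> m ^ s" using assms by (intro power_increasing) auto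
  finally have "(m choose s) * (m choose (m + 1 - s)) \<le> m ^ s * m ^ s"
    using assms by (intro mult_mono binomial_le_pow) auto
  also have "\<dots> = (m ^ 2) ^ s" by (simp add: power_mult_distrib power2_eq_square)
  finally show ?thesis .
qed

text \<open>
  The contribution of rectangles with sides \<open>s\<close> and \<open>m + 1 - s\<close> to the union bound. With \<open>a\<close> the
  shorter side, there are at most \<open>(m ^ 2) ^ a\<close> such rectangles, as choosing all but \<open>a - 1\<close>
  elements is choosing \<open>a - 1\<close>; the area is at least \<open>a * m / 2\<close>. So the bound is an \<open>a\<close>-th power,
  largest for \<open>a = 1\<close>.
\<close>

lemma binomial_product_exp_le:
  fixes c :: real
  assumes "1 \<le> s" "s \<le> m" "c \<ge> 0" "real m ^ 2 * exp (- c * m / 2) \<le> 1"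
  shows "real (m choose s) * real (m choose (m + 1 - s)) * exp (- c * (real s * real (m + 1 - s)))
    \<le> real m ^ 2 * exp (- c * m / 2)"
proof -
  define a where "a = min s (m + 1 - s)"
  have a: "1 \<le> a" "a \<le> m" "2 * a \<le> m + 1" using assms by (auto simp: a_def)
  have "(m choose s) * (m choose (m + 1 - s)) \<le> (m ^ 2) ^ a"
    using binomial_product_le[of s m] binomial_product_le[of "m + 1 - s" m] assms(1,2)
    by (auto simp: a_def min_def mult.commute)
  hence 1: "real (m choose s) * real (m choose (m + 1 - s)) \<le> (real m ^ 2) ^ a"
    unfolding of_nat_mult[symmetric] of_nat_power[symmetric] of_nat_le_iff .
  have "real s * real (m + 1 - s) = real a * (real (m + 1) - real a)"
    using assms(1,2) by (auto simp: a_def min_def of_nat_diff algebra_simps)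
  moreover have "real a * (real m / 2) \<le> real a * (real (m + 1) - real a)"
    using a by (intro mult_left_mono) auto
  ultimately have "c * (real a * (real m / 2)) \<le> c * (real s * real (m + 1 - s))"
    using assms(3) by (intro mult_left_mono) auto
  hence 2: "exp (- c * (real s * real (m + 1 - s))) \<le> exp (- c * m / 2) ^ a"
    unfolding exp_of_nat_mult[symmetric] by (simp add: algebra_simps)
  have "real (m choose s) * real (m choose (m + 1 - s)) * exp (- c * (real s * real (m + 1 - s)))
      \<le> (real m ^ 2) ^ a * exp (- c * m / 2) ^ a"
    by (intro mult_mono 1 2) auto
  also have "\<dots> = (real m ^ 2 * exp (- c * m / 2)) ^ a" by (simp add: power_mult_distrib)
  also have "\<dots> \<le> (real m ^ 2 * exp (- c * m / 2)) ^ 1"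
    using a assms(4) by (intro power_decreasing) auto
  finally show ?thesis by simp
qed

lemma prob_no_perfect_matching_le:
  fixes M :: "'f pmf" and c :: real and ok :: "'f \<Rightarrow> 'v \<Rightarrow> 'w \<Rightarrow> bool"
  assumes "finite A" "finite B" "card A = m" "card B = m" "m \<ge> 1" "c \<ge> 0"
    and rect: "\<And>S T. S \<subseteq> A \<Longrightarrow> T \<subseteq> B \<Longrightarrow>
      measure_pmf.prob M {f. \<forall>v\<in>S. \<forall>w\<in>T. \<not> ok f v w} \<le> exp (- c * (real (card S) * real (card T)))"
  shows "measure_pmf.prob M {f. \<not> (\<exists>\<sigma>. bij_betw \<sigma> A B \<and> (\<forall>v\<in>A. ok f v (\<sigma> v)))}
    \<le> real m ^ 3 * exp (- c * m / 2)"
proof (cases "real m ^ 2 * exp (- c * m / 2) \<le> 1")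
  case False
  \<comment> \<open>The bound exceeds 1, so there is nothing to prove.\<close>
  have "1 \<le> real m ^ 2 * exp (- c * m / 2)" using False by simp
  also have "\<dots> \<le> real m ^ 3 * exp (- c * m / 2)"
    using \<open>m \<ge> 1\<close> by (intro mult_right_mono power_increasing) auto
  finally show ?thesis
    using measure_pmf.prob_le_1[of M] order.trans by blast
next
  case True
  define R where "R s = {S. S \<subseteq> A \<and> card S = s} \<times> {T. T \<subseteq> B \<and> card T = m + 1 - s}" for s
  define X where "X = (\<lambda>(S, T). {f. \<forall>v\<in>S. \<forall>w\<in>T. \<not> ok f v w})"
  have finR: "finite (R s)" for s using assms(1,2) by (auto simp: R_def)
  have cardR: "card (R s) = (m choose s) * (m choose (m + 1 - s))" for s
    using assms(1-4) by (simp add: R_def card_cartesian_product n_subsets)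
  have "{f. \<not> (\<exists>\<sigma>. bij_betw \<sigma> A B \<and> (\<forall>v\<in>A. ok f v (\<sigma> v)))} \<subseteq> (\<Union>s\<in>{1..m}. \<Union>ST\<in>R s. X ST)"
  proof
    fix f assume "f \<in> {f. \<not> (\<exists>\<sigma>. bij_betw \<sigma> A B \<and> (\<forall>v\<in>A. ok f v (\<sigma> v)))}"
    with perfect_matching_or_empty_rectangle[OF assms(1,2), of "ok f"] assms(3,4)
    obtain S T where ST: "S \<subseteq> A" "T \<subseteq> B" "card S + card T = m + 1" "\<forall>v\<in>S. \<forall>w\<in>T. \<not> ok f v w"
      by auto
    have "card S \<le> m" "card T \<le> m"
      using ST card_mono[OF assms(1) ST(1)] card_mono[OF assms(2) ST(2)] assms(3,4) by auto
    hence "card S \<in> {1..m}" "(S, T) \<in> R (card S)" "f \<in> X (S, T)"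
      using ST by (auto simp: R_def X_def)
    thus "f \<in> (\<Union>s\<in>{1..m}. \<Union>ST\<in>R s. X ST)" by blast
  qed
  hence "measure_pmf.prob M {f. \<not> (\<exists>\<sigma>. bij_betw \<sigma> A B \<and> (\<forall>v\<in>A. ok f v (\<sigma> v)))}
      \<le> measure_pmf.prob M (\<Union>s\<in>{1..m}. \<Union>ST\<in>R s. X ST)"
    by (intro measure_pmf.finite_measure_mono) auto
  also have "\<dots> \<le> (\<Sum>s\<in>{1..m}. measure_pmf.prob M (\<Union>ST\<in>R s. X ST))"
    by (intro measure_pmf.finite_measure_subadditive_finite) auto
  also have "\<dots> \<le> (\<Sum>s\<in>{1..m}. real m ^ 2 * exp (- c * m / 2))"
  proof (rule sum_mono)
    fix s assume s: "s \<in> {1..m}"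
    have "measure_pmf.prob M (\<Union>ST\<in>R s. X ST) \<le> (\<Sum>ST\<in>R s. measure_pmf.prob M (X ST))"
      using finR by (intro measure_pmf.finite_measure_subadditive_finite) auto
    also have "\<dots> \<le> (\<Sum>ST\<in>R s. exp (- c * (real s * real (m + 1 - s))))"
    proof (rule sum_mono)
      fix ST assume "ST \<in> R s"
      thus "measure_pmf.prob M (X ST) \<le> exp (- c * (real s * real (m + 1 - s)))"
        using rect[of "fst ST" "snd ST"] by (auto simp: R_def X_def)
    qed
    also have "\<dots> = real (m choose s) * real (m choose (m + 1 - s)) * exp (- c * (real s * real (m + 1 - s)))"
      by (simp add: cardR)
    also have "\<dots> \<le> real m ^ 2 * exp (- c * m / 2)"
      using s assms(6) True by (intro binomial_product_exp_le) auto
    finally show "measure_pmf.prob M (\<Union>ST\<in>R s. X ST) \<le> real m ^ 2 * exp (- c * m / 2)" .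
  qed
  also have "\<dots> = real m ^ 3 * exp (- c * m / 2)"
    by (simp add: power_numeral_reduce)
  finally show ?thesis .
qed

section \<open>Extending a packing class by class\<close>

abbreviation coins :: "'e set \<Rightarrow> real \<Rightarrow> ('e \<Rightarrow> bool) pmf" where
  "coins I p \<equiv> Pi_pmf I False (\<lambda>_. bernoulli_pmf p)"

text \<open>
  No pair of \<open>S \<times> T\<close> is allowed if each \<open>(v, w)\<close> is blocked by a coin \<open>{\<phi> u, w}\<close> with \<open>u\<close> a
  neighbour of \<open>v\<close>. As \<open>T\<close> avoids the image of \<open>\<phi>\<close>, such a coin determines \<open>u\<close> and \<open>w\<close>, so it can block
  only the pairs \<open>(v, w)\<close> with \<open>v\<close> adjacent to \<open>u\<close>: at most \<open>k\<close> of them.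
\<close>

lemma prob_rectangle_hit_le:
  fixes E :: "'a set set" and \<phi> :: "'a \<Rightarrow> 'b"
  assumes fin: "finite U" "finite S" "finite T" "finite I"
    and \<phi>: "inj_on \<phi> U" and disj: "\<phi> ` U \<inter> T = {}"
    and I: "\<And>u w. u \<in> U \<Longrightarrow> w \<in> T \<Longrightarrow> {\<phi> u, w} \<in> I"
    and p: "0 < p" "p \<le> 1" and k: "k > 0"
    and deg: "\<And>v. v \<in> S \<Longrightarrow> card {u \<in> U. {u, v} \<in> E} \<le> D"
    and codeg: "\<And>u. u \<in> U \<Longrightarrow> card {v \<in> S. {u, v} \<in> E} \<le> k"
  shows "measure_pmf.prob (coins I p) {f. \<forall>v\<in>S. \<forall>w\<in>T. \<exists>u\<in>U. {u, v} \<in> E \<and> f {\<phi> u, w}}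
    \<le> exp (- ((1 - p) ^ D / k) * (real (card S) * real (card T)))"
proof -
  define N where "N = (\<lambda>(v, w). (\<lambda>u. {\<phi> u, w}) ` {u \<in> U. {u, v} \<in> E})"
  have "{f. \<forall>v\<in>S. \<forall>w\<in>T. \<exists>u\<in>U. {u, v} \<in> E \<and> f {\<phi> u, w}} = {f. \<forall>j\<in>S \<times> T. \<exists>x\<in>N j. f x}"
    by (auto simp: N_def)
  also have "measure_pmf.prob (coins I p) \<dots> \<le> (\<Prod>j\<in>S \<times> T. 1 - (1 - p) ^ card (N j)) powr (1 / k)"
  proof (rule prob_all_hit_le)
    show "N j \<subseteq> I" if "j \<in> S \<times> T" for j
      using that I by (auto simp: N_def)
  next
    fix x assume "x \<in> I"
    show "card {j \<in> S \<times> T. x \<in> N j} \<le> k"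
    proof (cases "{j \<in> S \<times> T. x \<in> N j} = {}")
      case False
      then obtain v0 w0 u0 where 0: "w0 \<in> T" "u0 \<in> U" "x = {\<phi> u0, w0}"
        by (auto simp: N_def)
      have "{j \<in> S \<times> T. x \<in> N j} \<subseteq> (\<lambda>v. (v, w0)) ` {v \<in> S. {u0, v} \<in> E}"
      proof
        fix j assume "j \<in> {j \<in> S \<times> T. x \<in> N j}"
        then obtain v w u where j: "j = (v, w)" "v \<in> S" "w \<in> T" "u \<in> U" "{u, v} \<in> E" "x = {\<phi> u, w}"
          by (auto simp: N_def)
        have "\<phi> u = \<phi> u0" "w = w0"
          using j 0 disj by (auto simp: doubleton_eq_iff)
        moreover have "u = u0" using inj_onD[OF \<phi> \<open>\<phi> u = \<phi> u0\<close>] j 0 by auto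
        ultimately show "j \<in> (\<lambda>v. (v, w0)) ` {v \<in> S. {u0, v} \<in> E}" using j by auto
      qed
      hence "card {j \<in> S \<times> T. x \<in> N j} \<le> card ((\<lambda>v. (v, w0)) ` {v \<in> S. {u0, v} \<in> E})"
        using fin by (intro card_mono) auto
      also have "\<dots> \<le> card {v \<in> S. {u0, v} \<in> E}"
        using fin by (intro card_image_le) auto
      also have "\<dots> \<le> k" using codeg 0 by auto
      finally show ?thesis .
    qed (simp only: card.empty)
  qed (use fin p k in auto)
  also have "\<dots> \<le> (\<Prod>j\<in>S \<times> T. exp (- ((1 - p) ^ D))) powr (1 / k)"
  proof (intro powr_mono2 prod_nonneg prod_mono conjI ballI)
    fix j assume j: "j \<in> S \<times> T"
    obtain v w where vw: "j = (v, w)" by force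
    have "card (N j) \<le> card {u \<in> U. {u, v} \<in> E}"
      using fin by (auto simp: N_def vw intro: card_image_le)
    also have "\<dots> \<le> D" using j deg by (auto simp: vw)
    finally have "(1 - p) ^ D \<le> (1 - p) ^ card (N j)"
      using p by (intro power_decreasing) auto
    moreover have "1 + - ((1 - p) ^ D) \<le> exp (- ((1 - p) ^ D))" by (rule exp_ge_add_one_self)
    ultimately show "1 - (1 - p) ^ card (N j) \<le> exp (- ((1 - p) ^ D))" by linarith
  qed (use p in \<open>auto simp: power_le_one\<close>)
  also have "\<dots> = exp (- ((1 - p) ^ D / k) * (real (card S) * real (card T)))"
    by (simp add: exp_of_nat_mult[symmetric] exp_powr_real card_cartesian_product)
  finally show ?thesis .
qed

text \<open>
  Conditioning on the first component: this is how one round uses the outcome of the earlier rounds.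
\<close>

lemma prob_pair_pmf_le:
  assumes "\<And>x. x \<notin> X \<Longrightarrow> measure_pmf.prob N {y. (x, y) \<in> Z} \<le> z" "z \<ge> 0"
  shows "measure_pmf.prob (pair_pmf M N) Z \<le> measure_pmf.prob M X + z"
proof -
  have "pair_pmf M N = bind_pmf M (\<lambda>x. map_pmf (Pair x) N)"
    by (simp add: pair_pmf_def map_pmf_def)
  hence "measure_pmf.prob (pair_pmf M N) Z
      = measure_pmf.expectation M (\<lambda>x. measure_pmf.prob N {y. (x, y) \<in> Z})"
    by (simp add: prob_bind_pmf vimage_def)
  also have "\<dots> \<le> measure_pmf.expectation M (\<lambda>x. indicator X x + z)"
  proof (rule integral_mono)
    fix x show "measure_pmf.prob N {y. (x, y) \<in> Z} \<le> indicator X x + z"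
      using assms measure_pmf.prob_le_1[of N "{y. (x, y) \<in> Z}"]
      by (cases "x \<in> X") (auto intro: order.trans)
  qed (auto intro!: measure_pmf.integrable_const_bound[where B = 1] Bochner_Integration.integrable_add)
  also have "\<dots> = measure_pmf.prob M X + z"
    by (subst Bochner_Integration.integral_add)
       (auto intro!: measure_pmf.integrable_const_bound[where B = 1])
  finally show ?thesis .
qed

text \<open>
  The random graph enters through the outcome \<open>f\<close> of its coins, so that statements about \<open>V\<close>
  depend only on the coins in \<open>all_edges V\<close>.
\<close>

definition partial_packing :: "'a set set \<Rightarrow> ('a \<Rightarrow> 'b) \<Rightarrow> 'a set \<Rightarrow> 'b set \<Rightarrow> ('b set \<Rightarrow> bool) \<Rightarrow> bool" where
  "partial_packing E \<phi> U V f \<longleftrightarrow> bij_betw \<phi> U V \<and> (\<forall>e\<in>E. e \<subseteq> U \<longrightarrow> \<not> f (\<phi> ` e))"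

lemma finite_all_edges: "finite V \<Longrightarrow> finite (all_edges V)"
  by (rule finite_subset[of _ "Pow V"]) (auto simp: all_edges_def)

lemma all_edges_mono: "U \<subseteq> V \<Longrightarrow> all_edges U \<subseteq> all_edges V"
  by (auto simp: all_edges_def)

text \<open>
  The coins inside \<open>V\<close> are those of the earlier rounds, all others are fresh. An edge of \<open>E\<close> in
  \<open>A \<union> U\<close> lies in \<open>U\<close> or joins \<open>U\<close> to \<open>A\<close>, because \<open>A\<close> is independent.
\<close>

lemma partial_packing_extend:
  assumes E: "\<And>e. e \<in> E \<Longrightarrow> card e = 2"
    and UA: "U \<inter> A = {}" "V \<inter> B = {}"
    and indep: "\<And>u v. u \<in> A \<Longrightarrow> v \<in> A \<Longrightarrow> {u, v} \<notin> E"
    and \<phi>: "partial_packing E \<phi> U V f"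
    and \<sigma>: "bij_betw \<sigma> A B" "\<And>u v. u \<in> U \<Longrightarrow> v \<in> A \<Longrightarrow> {u, v} \<in> E \<Longrightarrow> \<not> g {\<phi> u, \<sigma> v}"
  shows "partial_packing E (\<lambda>x. if x \<in> U then \<phi> x else \<sigma> x) (A \<union> U) (B \<union> V)
    (\<lambda>e. if e \<in> all_edges V then f e else g e)"
  unfolding partial_packing_def
proof (intro conjI ballI impI)
  let ?\<rho> = "\<lambda>x. if x \<in> U then \<phi> x else \<sigma> x"
  have bij: "bij_betw \<phi> U V" and no: "\<And>e. e \<in> E \<Longrightarrow> e \<subseteq> U \<Longrightarrow> \<not> f (\<phi> ` e)"
    using \<phi> by (auto simp: partial_packing_def)
  have bU: "bij_betw ?\<rho> U V"
    using bij by (subst bij_betw_cong[where g = \<phi>]) auto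
  have bA: "bij_betw ?\<rho> A B"
    using \<sigma>(1) UA(1) by (subst bij_betw_cong[where g = \<sigma>]) auto
  show "bij_betw ?\<rho> (A \<union> U) (B \<union> V)"
    using bij_betw_combine[OF bA bU] UA(2) by auto
  fix e assume e: "e \<in> E" "e \<subseteq> A \<union> U"
  obtain a b where ab: "e = {a, b}" "a \<noteq> b"
    using E[OF e(1)] by (auto simp: card_2_iff)
  show "\<not> (if ?\<rho> ` e \<in> all_edges V then f (?\<rho> ` e) else g (?\<rho> ` e))"
  proof (cases "e \<subseteq> U")
    case True
    hence "?\<rho> ` e = \<phi> ` e" by (intro image_cong) auto
    moreover have "\<phi> ` e \<in> all_edges V"
      using True bij E[OF e(1)] by (auto simp: all_edges_def bij_betw_def card_image inj_on_subset)
    ultimately show ?thesis using no[OF e(1) True] by simp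
  next
    case False
    have "\<not> (a \<in> A \<and> b \<in> A)" using indep e(1) by (auto simp: ab)
    then obtain u v where uv: "e = {u, v}" "u \<in> U" "v \<in> A"
      using False e(2) ab by (auto simp: insert_commute)
    have "?\<rho> ` e = {\<phi> u, \<sigma> v}" using uv UA(1) by auto
    moreover have "\<sigma> v \<in> B" using \<sigma>(1) uv by (auto simp: bij_betw_def)
    hence "{\<phi> u, \<sigma> v} \<notin> all_edges V" using UA(2) by (auto simp: all_edges_def)
    moreover have "\<not> g {\<phi> u, \<sigma> v}" using \<sigma>(2)[OF uv(2,3)] e(1) uv(1) by simp
    ultimately show ?thesis by simp
  qed
qed

lemma prob_extension_fails_le:
  fixes E :: "'a set set" and \<phi> :: "'a \<Rightarrow> 'b"
  assumes fin: "finite U" "finite A" "finite I" and card: "card A = card B" "card A = m" "m \<ge> 1"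
    and \<phi>: "inj_on \<phi> U" and disj: "\<phi> ` U \<inter> B = {}"
    and I: "\<And>u w. u \<in> U \<Longrightarrow> w \<in> B \<Longrightarrow> {\<phi> u, w} \<in> I"
    and p: "0 < p" "p \<le> 1" and k: "k > 0"
    and deg: "\<And>v. v \<in> A \<Longrightarrow> card {u \<in> U. {u, v} \<in> E} \<le> D"
    and codeg: "\<And>u. u \<in> U \<Longrightarrow> card {v \<in> A. {u, v} \<in> E} \<le> k"
  shows "measure_pmf.prob (coins I p) {f. \<not> (\<exists>\<sigma>. bij_betw \<sigma> A B \<and>
        (\<forall>v\<in>A. \<forall>u\<in>U. {u, v} \<in> E \<longrightarrow> \<not> f {\<phi> u, \<sigma> v}))}
    \<le> real m ^ 3 * exp (- ((1 - p) ^ D / k) * m / 2)"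
proof (rule prob_no_perfect_matching_le)
  show finB: "finite B" using card by (metis card.infinite not_one_le_zero)
  fix S T assume ST: "S \<subseteq> A" "T \<subseteq> B"
  have "{f. \<forall>v\<in>S. \<forall>w\<in>T. \<not> (\<forall>u\<in>U. {u, v} \<in> E \<longrightarrow> \<not> f {\<phi> u, w})}
      = {f. \<forall>v\<in>S. \<forall>w\<in>T. \<exists>u\<in>U. {u, v} \<in> E \<and> f {\<phi> u, w}}" by blast
  also have "measure_pmf.prob (coins I p) \<dots> \<le> exp (- ((1 - p) ^ D / k) * (real (card S) * real (card T)))"
  proof (rule prob_rectangle_hit_le)
    show "card {v \<in> S. {u, v} \<in> E} \<le> k" if "u \<in> U" for u
    proof -
      have "card {v \<in> S. {u, v} \<in> E} \<le> card {v \<in> A. {u, v} \<in> E}"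
        using ST fin by (intro card_mono) auto
      thus ?thesis using codeg[OF that] by simp
    qed
  qed (use assms ST finB in \<open>auto intro: finite_subset\<close>)
  finally show "measure_pmf.prob (coins I p) {f. \<forall>v\<in>S. \<forall>w\<in>T. \<not> (\<forall>u\<in>U. {u, v} \<in> E \<longrightarrow> \<not> f {\<phi> u, w})}
    \<le> exp (- ((1 - p) ^ D / k) * (real (card S) * real (card T)))" .
qed (use assms in auto)

text \<open>
  The classes are embedded one by one onto the sets \<open>\<psi> ` A\<close>; the map \<open>\<psi>\<close> serves only to fix these
  targets in advance. Each round fails with probability at most \<open>z\<close>, whatever partial packing the
  coins inside the earlier targets have led to.
\<close>

lemma prob_no_partial_packing_le:
  fixes E :: "'a set set" and \<psi> :: "'a \<Rightarrow> 'b" and p z :: real and k D :: nat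
  assumes "finite \<C>" "disjoint \<C>"
    and E: "\<And>e. e \<in> E \<Longrightarrow> card e = 2"
    and V: "finite V" "\<Union>\<C> \<subseteq> V" "inj_on \<psi> V"
    and p: "0 < p" "p \<le> 1" and k: "k > 0" and z: "z \<ge> 0"
    and deg: "\<And>v. v \<in> V \<Longrightarrow> card {u \<in> V. {u, v} \<in> E} \<le> D"
    and ne: "\<And>A. A \<in> \<C> \<Longrightarrow> A \<noteq> {}"
    and indep: "\<And>A u v. A \<in> \<C> \<Longrightarrow> u \<in> A \<Longrightarrow> v \<in> A \<Longrightarrow> {u, v} \<notin> E"
    and codeg: "\<And>A u. A \<in> \<C> \<Longrightarrow> u \<in> V \<Longrightarrow> card {v \<in> A. {u, v} \<in> E} \<le> k"
    and bound: "\<And>A. A \<in> \<C> \<Longrightarrow> real (card A) ^ 3 * exp (- ((1 - p) ^ D / k) * card A / 2) \<le> z"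
  shows "measure_pmf.prob (coins (all_edges (\<psi> ` \<Union>\<C>)) p) {f. \<nexists>\<phi>. partial_packing E \<phi> (\<Union>\<C>) (\<psi> ` \<Union>\<C>) f}
    \<le> card \<C> * z"
  using assms(1,2) V(2) ne indep codeg bound
proof (induction \<C> rule: finite_induct)
  case empty
  have "partial_packing E (\<lambda>_. undefined) {} ({}::'b set) f" for f
    using E[of "{}"] by (auto simp: partial_packing_def bij_betw_def)
  hence "{f. \<nexists>\<phi>. partial_packing E \<phi> {} ({}::'b set) f} = {}" by blast
  thus ?case by simp
next
  case (insert A \<C>)
  define U where "U = \<Union>\<C>"
  have UA: "U \<inter> A = {}" "U \<subseteq> V" "A \<subseteq> V"
    using insert.prems insert.hyps by (auto simp: U_def pairwise_insert disjnt_def)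
  have UA': "\<psi> ` U \<inter> \<psi> ` A = {}"
    using UA inj_on_image_Int[OF V(3), of U A] by auto
  have fin: "finite U" "finite A" using UA V(1) by (auto intro: finite_subset)
  define F where "F = all_edges (\<psi> ` U)"
  define I where "I = all_edges (\<psi> ` A \<union> \<psi> ` U) - F"
  have finFI: "finite F" "finite I"
    using fin by (auto simp: F_def I_def finite_all_edges)
  have FI: "all_edges (\<psi> ` A \<union> \<psi> ` U) = F \<union> I" "F \<inter> I = {}"
    using all_edges_mono[of "\<psi> ` U" "\<psi> ` A \<union> \<psi> ` U"] by (auto simp: F_def I_def)
  define X where "X = {f. \<nexists>\<phi>. partial_packing E \<phi> U (\<psi> ` U) f}"
  define merge where "merge = (\<lambda>(f, g) x. if x \<in> F then f x else (g x :: bool))"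
  have IH: "measure_pmf.prob (coins F p) X \<le> card \<C> * z"
    unfolding F_def X_def U_def using insert.prems
    by (intro insert.IH) (auto simp: pairwise_insert)
  have "measure_pmf.prob (coins (F \<union> I) p) {f. \<nexists>\<phi>. partial_packing E \<phi> (A \<union> U) (\<psi> ` A \<union> \<psi> ` U) f}
      = measure_pmf.prob (pair_pmf (coins F p) (coins I p))
          {fg. \<nexists>\<phi>. partial_packing E \<phi> (A \<union> U) (\<psi> ` A \<union> \<psi> ` U) (merge fg)}"
    by (subst Pi_pmf_union[OF finFI FI(2)]) (simp add: vimage_def merge_def)
  also have "\<dots> \<le> measure_pmf.prob (coins F p) X + z"
  proof (rule prob_pair_pmf_le)
    fix f assume "f \<notin> X"
    then obtain \<phi> where \<phi>: "partial_packing E \<phi> U (\<psi> ` U) f" by (auto simp: X_def)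
    hence bij: "inj_on \<phi> U" "\<phi> ` U = \<psi> ` U" by (auto simp: partial_packing_def bij_betw_def)
    have A: "card A \<ge> 1"
      using insert.prems(3)[of A] fin by (simp add: Suc_le_eq card_gt_0_iff)
    have "{g. (f, g) \<in> {fg. \<nexists>\<phi>. partial_packing E \<phi> (A \<union> U) (\<psi> ` A \<union> \<psi> ` U) (merge fg)}}
       \<subseteq> {g. \<not> (\<exists>\<sigma>. bij_betw \<sigma> A (\<psi> ` A) \<and> (\<forall>v\<in>A. \<forall>u\<in>U. {u, v} \<in> E \<longrightarrow> \<not> g {\<phi> u, \<sigma> v}))}"
    proof (rule Collect_mono, intro impI notI)
      fix g assume *: "(f, g) \<in> {fg. \<nexists>\<phi>. partial_packing E \<phi> (A \<union> U) (\<psi> ` A \<union> \<psi> ` U) (merge fg)}"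
      assume "\<exists>\<sigma>. bij_betw \<sigma> A (\<psi> ` A) \<and> (\<forall>v\<in>A. \<forall>u\<in>U. {u, v} \<in> E \<longrightarrow> \<not> g {\<phi> u, \<sigma> v})"
      then obtain \<sigma> where \<sigma>: "bij_betw \<sigma> A (\<psi> ` A)"
        "\<forall>v\<in>A. \<forall>u\<in>U. {u, v} \<in> E \<longrightarrow> \<not> g {\<phi> u, \<sigma> v}" by blast
      have "partial_packing E (\<lambda>x. if x \<in> U then \<phi> x else \<sigma> x) (A \<union> U) (\<psi> ` A \<union> \<psi> ` U) (merge (f, g))"
        unfolding merge_def F_def prod.case using insert.prems(4)[of A] \<sigma>
        by (intro partial_packing_extend[OF E UA(1) UA' _ \<phi>]) auto
      thus False using * by blast
    qed
    hence "measure_pmf.prob (coins I p) {g. (f, g) \<in> {fg. \<nexists>\<phi>. partial_packing E \<phi> (A \<union> U) (\<psi> ` A \<union> \<psi> ` U) (merge fg)}}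
      \<le> measure_pmf.prob (coins I p) {g. \<not> (\<exists>\<sigma>. bij_betw \<sigma> A (\<psi> ` A) \<and>
           (\<forall>v\<in>A. \<forall>u\<in>U. {u, v} \<in> E \<longrightarrow> \<not> g {\<phi> u, \<sigma> v}))}"
      by (intro measure_pmf.finite_measure_mono) auto
    also have "\<dots> \<le> real (card A) ^ 3 * exp (- ((1 - p) ^ D / k) * card A / 2)"
    proof (rule prob_extension_fails_le)
      show "card A = card (\<psi> ` A)"
        using UA(3) V(3) by (metis card_image inj_on_subset)
      show "\<phi> ` U \<inter> \<psi> ` A = {}" using bij(2) UA' by simp
      fix u w assume "u \<in> U" "w \<in> \<psi> ` A"
      moreover have "\<phi> u \<in> \<psi> ` U" using bij(2) \<open>u \<in> U\<close> by auto
      ultimately show "{\<phi> u, w} \<in> I"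
        using UA' by (auto simp: I_def F_def all_edges_def card_2_iff)
    next
      fix v assume v: "v \<in> A"
      have "card {u \<in> U. {u, v} \<in> E} \<le> card {u \<in> V. {u, v} \<in> E}"
        using UA(2) V(1) by (intro card_mono) auto
      thus "card {u \<in> U. {u, v} \<in> E} \<le> D" using deg[of v] v UA(3) by auto
    qed (use fin finFI p k bij A insert.prems(5)[of A] UA(2) in auto)
    also have "\<dots> \<le> z" by (intro insert.prems(6)) auto
    finally show "measure_pmf.prob (coins I p)
        {g. (f, g) \<in> {fg. \<nexists>\<phi>. partial_packing E \<phi> (A \<union> U) (\<psi> ` A \<union> \<psi> ` U) (merge fg)}} \<le> z" .
  qed (fact z)
  also have "\<dots> \<le> card \<C> * z + z" using IH by simp
  also have "\<dots> = card (insert A \<C>) * z" using insert.hyps by (simp add: algebra_simps)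
  finally show ?case by (simp add: U_def FI(1)[unfolded U_def] image_Un)
qed

section \<open>Partitions into spread independent classes\<close>

definition independent_in :: "'a set set \<Rightarrow> 'a set \<Rightarrow> bool" where
  "independent_in E A \<longleftrightarrow> (\<forall>u\<in>A. \<forall>v\<in>A. {u, v} \<notin> E)"

definition nbrs :: "'a set set \<Rightarrow> 'a set \<Rightarrow> 'a \<Rightarrow> 'a set" where
  "nbrs E A u = {v \<in> A. {u, v} \<in> E}"

lemma finite_nbrs: "finite A \<Longrightarrow> finite (nbrs E A u)"
  by (simp add: nbrs_def)

lemma ex_le_average:
  fixes f :: "'a \<Rightarrow> real"
  assumes "finite C" "C \<noteq> {}"
  shows "\<exists>v\<in>C. card C * f v \<le> (\<Sum>v\<in>C. f v)"
proof (rule ccontr)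
  assume "\<not> ?thesis"
  hence "(\<Sum>v\<in>C. \<Sum>w\<in>C. f w) < (\<Sum>v\<in>C. card C * f v)"
    using assms by (intro sum_strict_mono) (auto simp: not_le)
  thus False by (simp add: sum_distrib_left)
qed

text \<open>
  One vertex \<open>v\<close> is added at a time, chosen among at least \<open>s\<close> candidates of \<open>R\<close> outside \<open>A\<close> and its
  neighbourhood. Adding \<open>v\<close> multiplies the terms of its neighbours by \<open>b\<close>. Summed over the candidates,
  the increments are at most \<open>D * b\<close> times the potential, since each \<open>u\<close> is charged by at most
  \<open>D\<close> candidates; so some candidate increases it by a factor of at most \<open>1 + D * b / s\<close>.
\<close>

lemma ex_independent_small_potential:
  fixes E :: "'a set set" and b :: real and s m k D :: nat
  assumes E: "\<And>e. e \<in> E \<Longrightarrow> card e = 2" and V: "finite V" "R \<subseteq> V"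
    and deg: "\<And>v. v \<in> V \<Longrightarrow> card (nbrs E V v) \<le> D"
    and R: "s + m * (1 + D) \<le> card R" and s: "s \<ge> 1" and b: "b \<ge> 1"
  shows "\<exists>A\<subseteq>R. card A = m \<and> independent_in E A \<and>
    (\<Sum>u\<in>V. b ^ card (nbrs E A u)) \<le> card V * (1 + D * b / s) ^ m"
  using R
proof (induction m)
  case 0
  have "independent_in E {}" by (simp add: independent_in_def)
  thus ?case by (intro exI[of _ "{}"]) (auto simp: nbrs_def)
next
  case (Suc m)
  have "s + m * (1 + D) \<le> card R" using Suc.prems by simp
  from Suc.IH[OF this] obtain A where A: "A \<subseteq> R" "card A = m" "independent_in E A"
    and pot: "(\<Sum>u\<in>V. b ^ card (nbrs E A u)) \<le> card V * (1 + D * b / s) ^ m" by blast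
  define \<Phi> where "\<Phi> = (\<Sum>u\<in>V. b ^ card (nbrs E A u))"
  have fin: "finite R" using V by (auto intro: finite_subset)
  have fin: "finite R" "finite A" using fin A(1) by (auto intro: finite_subset)
  define C where "C = R - (A \<union> (\<Union>u\<in>A. nbrs E V u))"
  have finC: "finite C" using fin by (simp add: C_def)
  have "card (A \<union> (\<Union>u\<in>A. nbrs E V u)) \<le> card A + card (\<Union>u\<in>A. nbrs E V u)"
    by (rule card_Un_le)
  also have "card (\<Union>u\<in>A. nbrs E V u) \<le> (\<Sum>u\<in>A. card (nbrs E V u))"
    using fin by (intro card_UN_le)
  also have "\<dots> \<le> (\<Sum>u\<in>A. D)"
    using A V by (intro sum_mono deg) auto
  finally have "card (A \<union> (\<Union>u\<in>A. nbrs E V u)) \<le> m * (1 + D)"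
    using A by simp
  moreover have "card R - card (A \<union> (\<Union>u\<in>A. nbrs E V u)) \<le> card C"
    unfolding C_def using fin V by (intro diff_card_le_card_Diff) (auto simp: nbrs_def)
  ultimately have C: "s \<le> card C" using Suc.prems by simp
  hence "C \<noteq> {}" using s by auto
  have CV: "C \<subseteq> V" using V by (auto simp: C_def)
  \<comment> \<open>The increase of the potential when \<open>v\<close> is added to \<open>A\<close>.\<close>
  define f where "f v = (\<Sum>u\<in>nbrs E V v. (b - 1) * b ^ card (nbrs E A u))" for v
  have f0: "f v \<ge> 0" for v unfolding f_def using b by (intro sum_nonneg) auto
  obtain v where v: "v \<in> C" "card C * f v \<le> (\<Sum>v\<in>C. f v)"
    using ex_le_average[OF finC \<open>C \<noteq> {}\<close>] by blast
  have "s * f v \<le> card C * f v" using C f0 by (intro mult_right_mono) auto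
  also have "\<dots> \<le> (\<Sum>v\<in>C. f v)" by (fact v(2))
  also have "\<dots> = (\<Sum>v\<in>C. \<Sum>u\<in>{u\<in>V. {v, u} \<in> E}. (b - 1) * b ^ card (nbrs E A u))"
    by (simp add: f_def nbrs_def)
  also have "\<dots> = (\<Sum>u\<in>V. \<Sum>v\<in>{v\<in>C. {v, u} \<in> E}. (b - 1) * b ^ card (nbrs E A u))"
    by (rule sum.swap_restrict[OF finC V(1)])
  also have "\<dots> \<le> (\<Sum>u\<in>V. D * (b * b ^ card (nbrs E A u)))"
  proof (rule sum_mono)
    fix u assume u: "u \<in> V"
    have "card {v\<in>C. {v, u} \<in> E} \<le> card (nbrs E V u)"
      using CV V(1) by (intro card_mono finite_nbrs) (auto simp: nbrs_def insert_commute)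
    also have "\<dots> \<le> D" by (rule deg[OF u])
    finally have "card {v\<in>C. {v, u} \<in> E} * ((b - 1) * b ^ card (nbrs E A u)) \<le> D * (b * b ^ card (nbrs E A u))"
      using b by (intro mult_mono) auto
    thus "(\<Sum>v\<in>{v\<in>C. {v, u} \<in> E}. (b - 1) * b ^ card (nbrs E A u)) \<le> D * (b * b ^ card (nbrs E A u))"
      by simp
  qed
  also have "\<dots> = D * b * \<Phi>" by (simp add: \<Phi>_def sum_distrib_left mult.assoc)
  finally have fv: "f v \<le> D * b / s * \<Phi>" using s by (simp add: field_simps)
  have vA: "v \<notin> A" using v by (simp add: C_def)
  have nv: "nbrs E (insert v A) u = (if {u, v} \<in> E then insert v (nbrs E A u) else nbrs E A u)" for u
    by (auto simp: nbrs_def)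
  have "(\<Sum>u\<in>V. b ^ card (nbrs E (insert v A) u))
      = (\<Sum>u\<in>V. b ^ card (nbrs E A u) + (if {v, u} \<in> E then (b - 1) * b ^ card (nbrs E A u) else 0))"
  proof (intro sum.cong refl)
    fix u
    have "v \<notin> nbrs E A u" "finite (nbrs E A u)" using vA fin by (auto simp: nbrs_def)
    thus "b ^ card (nbrs E (insert v A) u) =
      b ^ card (nbrs E A u) + (if {v, u} \<in> E then (b - 1) * b ^ card (nbrs E A u) else 0)"
      unfolding nv by (simp add: insert_commute algebra_simps)
  qed
  also have "\<dots> = \<Phi> + f v"
    unfolding sum.distrib \<Phi>_def f_def nbrs_def sum.inter_filter[OF V(1)] ..
  also have "\<dots> \<le> (1 + D * b / s) * \<Phi>" using fv by (simp add: algebra_simps)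
  also have "\<dots> \<le> (1 + D * b / s) * (card V * (1 + D * b / s) ^ m)"
    using pot b unfolding \<Phi>_def[symmetric] by (intro mult_left_mono) auto
  finally have "(\<Sum>u\<in>V. b ^ card (nbrs E (insert v A) u)) \<le> card V * (1 + D * b / s) ^ Suc m"
    by (simp add: mult_ac)
  moreover have "independent_in E (insert v A)"
    using A(3) v(1) CV A(1) V(2) E[of "{v}"]
    by (auto simp: independent_in_def C_def nbrs_def insert_commute)
  moreover have "card (insert v A) = Suc m" using vA fin A(2) by simp
  moreover have "insert v A \<subseteq> R" using A v by (auto simp: C_def)
  ultimately show ?case by blast
qed

text \<open>
  A single vertex with more than \<open>k\<close> neighbours in \<open>A\<close> would already contribute
  \<open>b ^ (k + 1)\<close> to the potential.
\<close>

lemma ex_spread_independent_set: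
  fixes E :: "'a set set" and b :: real and s m k D :: nat
  assumes E: "\<And>e. e \<in> E \<Longrightarrow> card e = 2" and V: "finite V" "R \<subseteq> V"
    and deg: "\<And>v. v \<in> V \<Longrightarrow> card (nbrs E V v) \<le> D"
    and R: "s + m * (1 + D) \<le> card R" and s: "s \<ge> 1" and b: "b > 1"
    and k: "card V * (1 + D * b / s) ^ m < b ^ (k + 1)"
  shows "\<exists>A\<subseteq>R. card A = m \<and> independent_in E A \<and> (\<forall>u\<in>V. card (nbrs E A u) \<le> k)"
proof -
  have "b \<ge> 1" using b by simp
  from ex_independent_small_potential[OF E V deg R s this]
  obtain A where A: "A \<subseteq> R" "card A = m" "independent_in E A"
    "(\<Sum>u\<in>V. b ^ card (nbrs E A u)) \<le> card V * (1 + D * b / s) ^ m" by blast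
  have "card (nbrs E A u) \<le> k" if "u \<in> V" for u
  proof -
    have "b ^ card (nbrs E A u) \<le> (\<Sum>u\<in>V. b ^ card (nbrs E A u))"
      using that V(1) b by (intro member_le_sum) auto
    also have "\<dots> < b ^ (k + 1)" using A(4) k by linarith
    finally have "card (nbrs E A u) < k + 1" by (rule power_less_imp_less_exp[OF b])
    thus ?thesis by simp
  qed
  with A show ?thesis by blast
qed

lemma ex_disjoint_family:
  assumes "finite R" "m \<ge> 1" "r \<ge> 1"
    and "\<And>S. S \<subseteq> R \<Longrightarrow> card S \<ge> r \<Longrightarrow> \<exists>A\<subseteq>S. card A = m \<and> P A"
  shows "\<exists>\<G>. finite \<G> \<and> disjoint \<G> \<and> \<Union>\<G> \<subseteq> R \<and> card (R - \<Union>\<G>) < r \<and> (\<forall>A\<in>\<G>. card A = m \<and> P A)"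
  using assms(1,4)
proof (induction "card R" arbitrary: R rule: less_induct)
  case less
  show ?case
  proof (cases "card R < r")
    case True
    thus ?thesis by (intro exI[of _ "{}"]) auto
  next
    case False
    then obtain A where A: "A \<subseteq> R" "card A = m" "P A"
      using less.prems(2)[of R] by auto
    have "A \<noteq> {}" using A \<open>m \<ge> 1\<close> by auto
    have "card (R - A) < card R"
      using A(1) \<open>A \<noteq> {}\<close> less.prems(1) by (intro psubset_card_mono) auto
    hence "\<exists>\<G>. finite \<G> \<and> disjoint \<G> \<and> \<Union>\<G> \<subseteq> R - A \<and> card (R - A - \<Union>\<G>) < r \<and> (\<forall>A\<in>\<G>. card A = m \<and> P A)"
      using less.prems by (intro less.hyps) auto
    then obtain \<G> where \<G>: "finite \<G>" "disjoint \<G>" "\<Union>\<G> \<subseteq> R - A" "card (R - A - \<Union>\<G>) < r"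
      "\<forall>A\<in>\<G>. card A = m \<and> P A" by blast
    have "disjoint (insert A \<G>)"
      using \<G>(2,3) by (auto simp: pairwise_insert disjnt_def)
    moreover have "R - \<Union>(insert A \<G>) = R - A - \<Union>\<G>" by auto
    ultimately show ?thesis using \<G> A by (intro exI[of _ "insert A \<G>"]) auto
  qed
qed

text \<open>
  For the vertices left over by a maximal disjoint family. They are placed greedily; a vertex has to
  avoid the at most \<open>D\<close> classes that contain one of its neighbours and the classes already taken.
\<close>

lemma ex_injective_placement:
  fixes E :: "'a set set"
  assumes "finite L" "finite \<G>" "disjoint \<G>" "finite V" "\<Union>\<G> \<subseteq> V" "L \<subseteq> V"
    and deg: "\<And>v. v \<in> V \<Longrightarrow> card (nbrs E V v) \<le> D"
    and "card L + D \<le> card \<G>"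
  shows "\<exists>\<tau>. inj_on \<tau> L \<and> \<tau> ` L \<subseteq> \<G> \<and> (\<forall>v\<in>L. nbrs E (\<tau> v) v = {})"
  using assms(1,6,8)
proof (induction L rule: finite_induct)
  case (insert v L)
  then obtain \<tau> where \<tau>: "inj_on \<tau> L" "\<tau> ` L \<subseteq> \<G>" "\<forall>v\<in>L. nbrs E (\<tau> v) v = {}" by auto
  define Q where "Q = {A \<in> \<G>. nbrs E A v \<noteq> {}}"
  have "\<forall>A\<in>Q. \<exists>u. u \<in> nbrs E A v" by (auto simp: Q_def)
  then obtain h where h: "\<And>A. A \<in> Q \<Longrightarrow> h A \<in> nbrs E A v" by metis
  have "inj_on h Q"
  proof (rule inj_onI)
    fix A B assume AB: "A \<in> Q" "B \<in> Q" "h A = h B"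
    hence "h A \<in> A" "h A \<in> B" using h[of A] h[of B] by (auto simp: nbrs_def)
    thus "A = B" using AB assms(3) by (auto simp: Q_def pairwise_def disjnt_def)
  qed
  moreover have "h ` Q \<subseteq> nbrs E V v"
  proof
    fix u assume "u \<in> h ` Q"
    then obtain A where "A \<in> Q" "u \<in> nbrs E A v" using h by blast
    thus "u \<in> nbrs E V v" using assms(5) by (auto simp: Q_def nbrs_def)
  qed
  ultimately have "card Q \<le> card (nbrs E V v)"
    using finite_nbrs[OF assms(4)] by (intro card_inj_on_le[of h])
  also have "\<dots> \<le> D" using insert.prems(1) by (intro deg) auto
  finally have "card (Q \<union> \<tau> ` L) \<le> D + card L"
    using card_Un_le[of Q "\<tau> ` L"] card_image_le[OF insert.hyps(1), of \<tau>] by linarith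
  also have "\<dots> < card \<G>" using insert by simp
  finally have "\<not> \<G> \<subseteq> Q \<union> \<tau> ` L"
    using insert.hyps(1) assms(2) by (auto simp: Q_def not_le[symmetric] dest!: card_mono[rotated])
  then obtain A where A: "A \<in> \<G>" "nbrs E A v = {}" "A \<notin> \<tau> ` L" by (auto simp: Q_def)
  show ?case
    using \<tau> A insert.hyps by (intro exI[of _ "\<tau>(v := A)"]) (auto simp: inj_on_def)
qed auto

text \<open>
  Good sets of size exactly \<open>m\<close> are removed until fewer than \<open>r\<close> vertices remain, and these are then
  distributed to distinct classes. This explains the sizes \<open>m\<close> and \<open>m + 1\<close> and the bound \<open>k + 1\<close>. The
  assumption \<open>room\<close> says that there are enough classes for the distribution.
\<close>

lemma ex_spread_partition:
  fixes E :: "'a set set" and b :: real and s m k D :: nat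
  assumes E: "\<And>e. e \<in> E \<Longrightarrow> card e = 2" and V: "finite V"
    and deg: "\<And>v. v \<in> V \<Longrightarrow> card (nbrs E V v) \<le> D"
    and s: "s \<ge> 1" and m: "m \<ge> 1" and b: "b > 1"
    and k: "card V * (1 + D * b / s) ^ m < b ^ (k + 1)"
    and r: "r = s + m * (1 + D)" and room: "r + m * (r + D) \<le> card V"
  shows "\<exists>\<C>. finite \<C> \<and> disjoint \<C> \<and> \<Union>\<C> = V \<and> card \<C> \<le> card V \<and>
    (\<forall>A\<in>\<C>. m \<le> card A \<and> card A \<le> m + 1 \<and> independent_in E A \<and> (\<forall>u\<in>V. card (nbrs E A u) \<le> k + 1))"
proof -
  define P where "P A \<longleftrightarrow> independent_in E A \<and> (\<forall>u\<in>V. card (nbrs E A u) \<le> k)" for A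
  have "r \<ge> 1" using r s by simp
  moreover have "\<exists>A\<subseteq>S. card A = m \<and> P A" if "S \<subseteq> V" "card S \<ge> r" for S
    unfolding P_def using that r by (intro ex_spread_independent_set[OF E V _ deg _ s b k]) auto
  ultimately obtain \<G> where \<G>: "finite \<G>" "disjoint \<G>" "\<Union>\<G> \<subseteq> V" "card (V - \<Union>\<G>) < r"
      "\<And>A. A \<in> \<G> \<Longrightarrow> card A = m \<and> P A"
    using ex_disjoint_family[OF V m, of r P] by blast
  define L where "L = V - \<Union>\<G>"
  have fin: "finite L" "\<And>A. A \<in> \<G> \<Longrightarrow> finite A"
    using V \<G>(3) by (auto simp: L_def intro: finite_subset)
  have L: "L \<subseteq> V" by (auto simp: L_def)
  have "card (\<Union>\<G>) = m * card \<G>"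
    using \<G>(1,2,5) fin by (subst card_Union_disjoint) (auto simp: pairwise_def)
  moreover have "card V = card (\<Union>\<G>) + card L"
    unfolding L_def using V \<G>(3) by (metis card_Diff_subset card_mono finite_subset le_add_diff_inverse)
  ultimately have "r + m * (r + D) \<le> m * card \<G> + card L" using room by simp
  hence "m * (r + D) \<le> m * card \<G>" using \<G>(4) unfolding L_def[symmetric] by linarith
  hence "r + D \<le> card \<G>" using m by simp
  hence "card L + D \<le> card \<G>" using \<G>(4) unfolding L_def[symmetric] by linarith
  then obtain \<tau> where \<tau>: "inj_on \<tau> L" "\<tau> ` L \<subseteq> \<G>" "\<And>v. v \<in> L \<Longrightarrow> nbrs E (\<tau> v) v = {}"
    using ex_injective_placement[OF fin(1) \<G>(1,2) V \<G>(3) L deg] by auto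
  define X where "X A = {v \<in> L. \<tau> v = A}" for A
  have X: "X A = {} \<or> (\<exists>v\<in>L. \<tau> v = A \<and> X A = {v})" for A
    using inj_onD[OF \<tau>(1)] by (auto simp: X_def)
  define h where "h A = A \<union> X A" for A
  have AX: "A \<inter> X B = {}" if "A \<in> \<G>" for A B
    using that by (auto simp: X_def L_def)
  have disj: "h A \<inter> h B = {}" if "A \<in> \<G>" "B \<in> \<G>" "A \<noteq> B" for A B
  proof -
    have "A \<inter> B = {}" using that \<G>(2) by (auto simp: pairwise_def disjnt_def)
    moreover have "X A \<inter> X B = {}" using that by (auto simp: X_def)
    ultimately show ?thesis using AX[OF that(1), of B] AX[OF that(2), of A] unfolding h_def by blast
  qed
  have Un: "\<Union>(h ` \<G>) = V"
  proof
    show "\<Union>(h ` \<G>) \<subseteq> V" using \<G>(3) by (auto simp: h_def X_def L_def)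
    show "V \<subseteq> \<Union>(h ` \<G>)"
    proof
      fix v assume "v \<in> V"
      show "v \<in> \<Union>(h ` \<G>)"
      proof (cases "v \<in> L")
        case True
        hence "v \<in> h (\<tau> v)" "\<tau> v \<in> \<G>" using \<tau>(2) by (auto simp: h_def X_def)
        thus ?thesis by blast
      next
        case False
        thus ?thesis using \<open>v \<in> V\<close> by (auto simp: h_def L_def)
      qed
    qed
  qed
  have each: "m \<le> card (h A) \<and> card (h A) \<le> m + 1 \<and> independent_in E (h A) \<and> (\<forall>u\<in>V. card (nbrs E (h A) u) \<le> k + 1)"
    if A: "A \<in> \<G>" for A
    using X[of A]
  proof
    assume "X A = {}"
    thus ?thesis using \<G>(5)[OF A] by (auto simp: h_def P_def intro: le_SucI)
  next
    assume "\<exists>v\<in>L. \<tau> v = A \<and> X A = {v}"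
    then obtain v where v: "v \<in> L" "\<tau> v = A" "h A = insert v A" by (auto simp: h_def)
    have "v \<notin> A" using v A by (auto simp: L_def)
    have "independent_in E (insert v A)"
      using \<G>(5)[OF A] \<tau>(3)[OF v(1)] v(2) E[of "{v}"]
      by (auto simp: P_def independent_in_def nbrs_def insert_commute)
    moreover have "card (nbrs E (insert v A) u) \<le> k + 1" if "u \<in> V" for u
    proof -
      have "card (nbrs E (insert v A) u) \<le> card (insert v (nbrs E A u))"
        using fin(2)[OF A] by (intro card_mono) (auto simp: nbrs_def)
      also have "\<dots> \<le> Suc (card (nbrs E A u))" by (rule card_insert_le_m1) auto
      also have "\<dots> \<le> k + 1" using \<G>(5)[OF A] that by (auto simp: P_def)
      finally show ?thesis .
    qed
    ultimately show ?thesis using v(3) \<open>v \<notin> A\<close> \<G>(5)[OF A] fin(2)[OF A] by auto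
  qed
  have disj': "disjoint (h ` \<G>)"
    using disj by (auto simp: pairwise_def disjnt_def)
  have "card (h ` \<G>) = (\<Sum>A\<in>h ` \<G>. 1)" by simp
  also have "\<dots> \<le> (\<Sum>A\<in>h ` \<G>. card A)"
    using each m by (intro sum_mono) (auto intro: order.trans)
  also have "\<dots> = card (\<Union>(h ` \<G>))"
    using disj' V Un by (subst card_Union_disjoint) (auto intro: finite_subset)
  finally have "card (h ` \<G>) \<le> card V" using Un by simp
  thus ?thesis using disj' Un each \<G>(1) by (intro exI[of _ "h ` \<G>"]) auto
qed

section \<open>Packing a random graph\<close>

text \<open>
  The lower bound for the probability that a pair is allowed, from
  \<open>1 - p \<ge> exp (- p / \<delta>)\<close> for \<open>p \<le> 1 - \<delta>\<close>.
\<close>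

lemma one_minus_power_ge_powr:
  fixes p \<delta> \<epsilon> x :: real and D :: nat
  assumes "0 \<le> p" "p \<le> 1 - \<delta>" "0 < \<delta>" "x > 0" "p * D \<le> \<epsilon> * ln x"
  shows "(1 - p) ^ D \<ge> x powr (- (\<epsilon> / \<delta>))"
proof -
  have pos: "1 - p > 0" using assms by simp
  have "1 / (1 - p) = 1 + p / (1 - p)" using pos by (simp add: field_simps)
  also have "\<dots> \<le> 1 + p / \<delta>"
    using assms pos by (intro add_left_mono divide_left_mono) auto
  also have "\<dots> \<le> exp (p / \<delta>)" by (rule exp_ge_add_one_self)
  finally have "exp (- (p / \<delta>)) \<le> 1 - p"
    using pos by (simp add: exp_minus field_simps)
  hence "exp (- (p / \<delta>)) ^ D \<le> (1 - p) ^ D" by (intro power_mono) auto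
  moreover have "exp (- (p / \<delta>)) ^ D = exp (- (p * D / \<delta>))"
    by (simp add: exp_of_nat_mult[symmetric] mult_ac)
  moreover have "exp (- (\<epsilon> * ln x / \<delta>)) \<le> exp (- (p * D / \<delta>))"
    using assms by (simp add: divide_right_mono)
  moreover have "x powr (- (\<epsilon> / \<delta>)) = exp (- (\<epsilon> * ln x / \<delta>))"
    using assms by (simp add: powr_def)
  ultimately show ?thesis by linarith
qed

lemma card_nbrs_le_max_degree:
  assumes G: "simple_graph G" and v: "v \<in> verts G"
  shows "card (nbrs (edges G) (verts G) v) \<le> max_degree G"
proof -
  have fin: "finite (verts G)" "finite (edges G)"
    using G finite_all_edges[of "verts G"] by (auto simp: simple_graph_def intro: finite_subset)
  have "card (nbrs (edges G) (verts G) v) \<le> degree G v"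
    unfolding degree_def nbrs_def
    by (rule card_inj_on_le[of "\<lambda>u. {v, u}"]) (use fin in \<open>auto simp: inj_on_def doubleton_eq_iff\<close>)
  also have "\<dots> \<le> max_degree G"
    unfolding max_degree_def using fin v by (intro Max_ge) auto
  finally show ?thesis .
qed

lemma prob_cannot_pack_le:
  fixes p :: real and n m k :: nat
  assumes G: "simple_graph G" "graph_order G = n" and p: "0 < p" "p \<le> 1"
    and \<C>: "finite \<C>" "disjoint \<C>" "\<Union>\<C> = verts G" "card \<C> \<le> n"
    and each: "\<And>A. A \<in> \<C> \<Longrightarrow> m \<le> card A \<and> card A \<le> m + 1 \<and> independent_in (edges G) A \<and>
        (\<forall>u\<in>verts G. card (nbrs (edges G) A u) \<le> k)"
    and m: "m \<ge> 1" and k: "k > 0"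
  shows "measure_pmf.prob (random_graph n p) {H. \<not> can_be_packed G H}
    \<le> n * (real (m + 1) ^ 3 * exp (- ((1 - p) ^ max_degree G * m / (2 * real k))))"
proof -
  define V where "V = verts G"
  define E where "E = edges G"
  define z where "z = real (m + 1) ^ 3 * exp (- ((1 - p) ^ max_degree G * m / (2 * real k)))"
  have V: "finite V" "card V = n" using G by (auto simp: V_def simple_graph_def graph_order_def)
  have E: "card e = 2" if "e \<in> E" for e
    using G(1) that by (auto simp: E_def simple_graph_def all_edges_def)
  obtain \<psi> where "bij_betw \<psi> V {0..<n}"
    using ex_bij_betw_finite_nat[OF V(1)] V(2) by auto
  hence \<psi>: "inj_on \<psi> V" "\<psi> ` V = {..<n}"
    by (auto simp: bij_betw_def atLeast0LessThan)
  have "measure_pmf.prob (random_graph n p) {H. \<not> can_be_packed G H}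
      = measure_pmf.prob (coins (all_edges {..<n}) p)
          {f. \<not> can_be_packed G ({..<n}, {e \<in> all_edges {..<n}. f e})}"
    by (simp add: random_graph_def vimage_def)
  also have "\<dots> \<le> measure_pmf.prob (coins (all_edges {..<n}) p) {f. \<nexists>\<phi>. partial_packing E \<phi> V {..<n} f}"
  proof (intro measure_pmf.finite_measure_mono Collect_mono impI notI)
    fix f assume "\<not> can_be_packed G ({..<n}, {e \<in> all_edges {..<n}. f e})"
      and "\<exists>\<phi>. partial_packing E \<phi> V {..<n} f"
    moreover have "e \<subseteq> V" if "e \<in> E" for e
      using G(1) that by (auto simp: E_def V_def simple_graph_def all_edges_def)
    ultimately show False
      by (auto simp: can_be_packed_def is_packing_def partial_packing_def V_def E_def)
  qed auto
  also have "\<dots> = measure_pmf.prob (coins (all_edges (\<psi> ` \<Union>\<C>)) p)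
      {f. \<nexists>\<phi>. partial_packing E \<phi> (\<Union>\<C>) (\<psi> ` \<Union>\<C>) f}"
    using \<C>(3) \<psi>(2) by (simp add: V_def)
  also have "\<dots> \<le> card \<C> * z"
  proof (rule prob_no_partial_packing_le[where V = V and D = "max_degree G" and k = k])
    show "card {u \<in> V. {u, v} \<in> E} \<le> max_degree G" if "v \<in> V" for v
      using card_nbrs_le_max_degree[OF G(1), of v] that
      by (simp add: V_def E_def nbrs_def insert_commute)
    show "real (card A) ^ 3 * exp (- ((1 - p) ^ max_degree G / k) * card A / 2) \<le> z" if "A \<in> \<C>" for A
      unfolding z_def
    proof (intro mult_mono power_mono)
      have "(1 - p) ^ max_degree G * m / (2 * real k) \<le> (1 - p) ^ max_degree G * card A / (2 * real k)"
        using each[OF that] p by (intro divide_right_mono mult_left_mono) auto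
      thus "exp (- ((1 - p) ^ max_degree G / k) * card A / 2) \<le> exp (- ((1 - p) ^ max_degree G * m / (2 * real k)))"
        by (simp add: mult_ac)
    qed (use each[OF that] in auto)
    show "A \<noteq> {}" if "A \<in> \<C>" for A using each[OF that] m by auto
    show "{u, v} \<notin> E" if "A \<in> \<C>" "u \<in> A" "v \<in> A" for A u v
      using each[OF that(1)] that by (auto simp: independent_in_def E_def)
    show "card {v \<in> A. {u, v} \<in> E} \<le> k" if "A \<in> \<C>" "u \<in> V" for A u
      using each[OF that(1)] that by (auto simp: nbrs_def E_def V_def)
    show "finite \<C>" "disjoint \<C>" by fact+
  qed (use V E \<psi> p k \<C>(3) in \<open>auto simp: z_def V_def\<close>)
  also have "\<dots> \<le> n * z"
    using \<C>(4) by (intro mult_right_mono) (auto simp: z_def)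
  finally show ?thesis unfolding z_def .
qed

text \<open>
  The choice of parameters. Up to constant factors, classes have size \<open>m = x powr (g / 8)\<close>, each
  vertex of a class is chosen among at least \<open>s = x powr (1 - g / 2)\<close> candidates, and the potential
  has base \<open>b = x powr (g / 8)\<close>. Then \<open>m * \<Delta> * b / s\<close> is at most \<open>2 * x powr (- g / 4)\<close>, so the
  potential stays at most \<open>exp 2 * x < x\<^sup>2\<close>, and \<open>k \<ge> 16 / g\<close> makes \<open>b ^ (k + 1)\<close> at least
  \<open>x\<^sup>2\<close>. The factor \<open>g / 16\<close> in the bound on \<open>p * \<Delta>\<close> makes a pair allowed with probability at
  least \<open>x powr (- g / 16)\<close>, which leaves \<open>x powr (g / 16)\<close> for the expected number of partners
  of a vertex within its class.
\<close>

lemma prob_cannot_pack_le_powr: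
  fixes g \<delta> p :: real and n :: nat
  defines "x \<equiv> real n"
  assumes g: "0 < g" "g \<le> 1" and \<delta>: "0 < \<delta>"
    and G: "simple_graph G" "graph_order G = n"
    and p: "0 < p" "p \<le> 1 - \<delta>"
    and D: "real (max_degree G) \<le> x powr (1 - g)"
    and pD: "p * max_degree G \<le> \<delta> * g / 16 * ln x"
    and large: "x \<ge> 10" "20 * x powr (1 - 3 * g / 8) \<le> x" "2 * x powr (g / 8) + 1 \<le> x"
  shows "measure_pmf.prob (random_graph n p) {H. \<not> can_be_packed G H}
    \<le> x ^ 4 * exp (- (x powr (g / 16) / (2 * (16 / g + 2))))"
proof -
  define V where "V = verts G"
  define E where "E = edges G"
  define \<Delta> where "\<Delta> = max_degree G"
  define m where "m = nat \<lceil>x powr (g / 8)\<rceil>"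
  define s where "s = nat \<lceil>x powr (1 - g / 2)\<rceil>"
  define k where "k = nat \<lceil>16 / g\<rceil>"
  define r where "r = s + m * (1 + \<Delta>)"
  have x: "x > 1" "x > 0" using large by auto
  have V: "finite V" "card V = n" using G by (auto simp: V_def simple_graph_def graph_order_def)
  have E: "card e = 2" if "e \<in> E" for e
    using G(1) that by (auto simp: E_def simple_graph_def all_edges_def)
  have ge1: "x powr a \<ge> 1" if "a \<ge> 0" for a using x that by (simp add: ge_one_powr_ge_zero)
  have mono: "x powr a \<le> x powr b" if "a \<le> b" for a b using x that by (simp add: powr_mono)
  have m: "x powr (g / 8) \<le> m" "m \<le> 2 * x powr (g / 8)"
    using ge1[of "g / 8"] g unfolding m_def by linarith+
  have s: "x powr (1 - g / 2) \<le> s" "s \<le> 2 * x powr (1 - g / 2)"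
    using ge1[of "1 - g / 2"] g unfolding s_def by linarith+
  have m1: "m \<ge> 1" using m(1) ge1[of "g / 8"] g by linarith
  have s1: "s \<ge> 1" using s(1) ge1[of "1 - g / 2"] g by linarith
  have \<Delta>: "real \<Delta> \<le> x powr (1 - g)" using D by (simp add: \<Delta>_def)
  have k: "16 / g \<le> k" "k \<le> 16 / g + 1" using g unfolding k_def by (auto; linarith)+
  have b: "x powr (g / 8) > 1" using x g by (simp add: gr_one_powr)
  have "real (card V) * (1 + \<Delta> * x powr (g / 8) / s) ^ m < (x powr (g / 8)) ^ (k + 1)"
  proof -
    have "\<Delta> * x powr (g / 8) / s \<le> x powr (1 - g) * x powr (g / 8) / x powr (1 - g / 2)"
      using \<Delta> s x by (intro frac_le mult_right_mono) auto
    also have "\<dots> = x powr (1 - g + g / 8 - (1 - g / 2))"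
      unfolding powr_add powr_diff ..
    finally have 1: "\<Delta> * x powr (g / 8) / s \<le> x powr (1 - g + g / 8 - (1 - g / 2))" .
    have "m * (\<Delta> * x powr (g / 8) / s) \<le> (2 * x powr (g / 8)) * x powr (1 - g + g / 8 - (1 - g / 2))"
      using m by (intro mult_mono 1) auto
    also have "\<dots> = 2 * x powr (- (g / 4))"
      by (simp add: powr_add[symmetric] field_simps)
    also have "\<dots> \<le> 2" using mono[of "- (g / 4)" 0] g x by simp
    finally have 2: "m * (\<Delta> * x powr (g / 8) / s) \<le> 2" .
    have "(1 + \<Delta> * x powr (g / 8) / s) ^ m \<le> exp (\<Delta> * x powr (g / 8) / s) ^ m"
      by (intro power_mono exp_ge_add_one_self) auto
    also have "\<dots> = exp (m * (\<Delta> * x powr (g / 8) / s))" by (simp only: exp_of_nat_mult)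
    also have "\<dots> \<le> exp 2" using 2 by simp
    also have "exp (2::real) = exp 1 * exp 1" by (simp flip: exp_add)
    also have "\<dots> \<le> 3 * 3" using exp_le by (intro mult_mono) auto
    also have "\<dots> < x" using large by simp
    finally have "real (card V) * (1 + \<Delta> * x powr (g / 8) / s) ^ m < x * x"
      using x unfolding x_def V(2) by (intro mult_strict_left_mono) auto
    also have "x * x = x powr 2" using x by (simp add: powr_numeral power2_eq_square)
    also have "\<dots> \<le> x powr (g / 8 * real (k + 1))"
      using k(1) g by (intro mono) (simp add: field_simps)
    also have "\<dots> = (x powr (g / 8)) ^ (k + 1)"
      using x unfolding powr_powr[symmetric] by (subst powr_realpow) auto
    finally show ?thesis .
  qed
  moreover have "r + m * (r + \<Delta>) \<le> card V"
  proof -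
    have "m * (1 + real \<Delta>) \<le> (2 * x powr (g / 8)) * (2 * x powr (1 - g))"
      using m \<Delta> ge1[of "1 - g"] g by (intro mult_mono) auto
    also have "\<dots> = 4 * x powr (1 - 7 * g / 8)"
      by (simp add: powr_add[symmetric] field_simps)
    also have "\<dots> \<le> 4 * x powr (1 - g / 2)" using mono g by simp
    finally have r: "real r \<le> 6 * x powr (1 - g / 2)"
      using s unfolding r_def of_nat_add of_nat_mult of_nat_1 by linarith
    have "real r + \<Delta> \<le> 7 * x powr (1 - g / 2)"
      using r \<Delta> mono[of "1 - g" "1 - g / 2"] g by simp
    hence "m * (real r + \<Delta>) \<le> (2 * x powr (g / 8)) * (7 * x powr (1 - g / 2))"
      using m by (intro mult_mono) auto
    also have "\<dots> = 14 * x powr (1 - 3 * g / 8)"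
      by (simp add: powr_add[symmetric] field_simps)
    finally have "real r + m * (real r + \<Delta>) \<le> 20 * x powr (1 - 3 * g / 8)"
      using r mono[of "1 - g / 2" "1 - 3 * g / 8"] g by simp
    also have "\<dots> \<le> real n" using large(2) unfolding x_def .
    finally have "real (r + m * (r + \<Delta>)) \<le> real (card V)" using V by simp
    thus ?thesis unfolding of_nat_le_iff .
  qed
  moreover have "card (nbrs E V v) \<le> \<Delta>" if "v \<in> V" for v
    using card_nbrs_le_max_degree[OF G(1)] that by (simp add: V_def E_def \<Delta>_def)
  ultimately have "\<exists>\<C>. finite \<C> \<and> disjoint \<C> \<and> \<Union>\<C> = V \<and> card \<C> \<le> card V \<and>
    (\<forall>A\<in>\<C>. m \<le> card A \<and> card A \<le> m + 1 \<and> independent_in E A \<and> (\<forall>u\<in>V. card (nbrs E A u) \<le> k + 1))"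
    using E V(1) s1 m1 b r_def by (intro ex_spread_partition[of E V \<Delta> s m "x powr (g / 8)" k r]) auto
  then obtain \<C> where \<C>: "finite \<C>" "disjoint \<C>" "\<Union>\<C> = V" "card \<C> \<le> n"
    "\<And>A. A \<in> \<C> \<Longrightarrow> m \<le> card A \<and> card A \<le> m + 1 \<and> independent_in E A \<and> (\<forall>u\<in>V. card (nbrs E A u) \<le> k + 1)"
    using V(2) by auto
  have "measure_pmf.prob (random_graph n p) {H. \<not> can_be_packed G H}
      \<le> n * (real (m + 1) ^ 3 * exp (- ((1 - p) ^ \<Delta> * m / (2 * real (k + 1)))))"
    unfolding \<Delta>_def using \<C> p \<delta> m1 by (intro prob_cannot_pack_le[OF G]) (auto simp: V_def E_def)
  also have "\<dots> \<le> x * (x ^ 3 * exp (- (x powr (g / 16) / (2 * (16 / g + 2)))))"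
  proof -
    have "x powr (- (g / 16)) \<le> (1 - p) ^ \<Delta>"
      using one_minus_power_ge_powr[of p \<delta> x \<Delta> "\<delta> * g / 16"] p \<delta> x pD by (simp add: \<Delta>_def)
    hence "x powr (- (g / 16)) * x powr (g / 8) \<le> (1 - p) ^ \<Delta> * m"
      using m p \<delta> by (intro mult_mono) auto
    moreover have "x powr (- (g / 16)) * x powr (g / 8) = x powr (g / 16)"
      by (simp add: powr_add[symmetric])
    ultimately have "x powr (g / 16) / (2 * (16 / g + 2)) \<le> (1 - p) ^ \<Delta> * m / (2 * real (k + 1))"
      using k g p \<delta> by (intro frac_le) auto
    moreover have "real (m + 1) \<le> x" using m(2) large(3) by simp
    ultimately show ?thesis
      unfolding x_def[symmetric] using x by (intro mult_mono power_mono) auto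
  qed
  finally show ?thesis by (simp add: power_numeral_reduce mult.assoc)
qed

theorem theorem2:
  fixes \<gamma> K \<delta> :: real
  assumes "\<gamma> > 0" and "K > 0" and "0 < \<delta>" and "\<delta> < 1"
  shows "\<exists>\<epsilon>>0. \<forall>(p :: nat \<Rightarrow> real) (q :: nat \<Rightarrow> real) (G\<^sub>1 :: nat \<Rightarrow> 'a ugraph).
    (\<forall>n\<ge>2. p n > 0 \<and> q n > 0
        \<and> p n \<le> 1 - \<delta>
        \<and> q n \<le> real n powr (- \<gamma>)
        \<and> p n * q n * real n \<le> \<epsilon> * ln (real n)
        \<and> simple_graph (G\<^sub>1 n) \<and> graph_order (G\<^sub>1 n) = n
        \<and> real (max_degree (G\<^sub>1 n)) \<le> q n * real n) \<longrightarrow>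
    (\<lambda>n. measure_pmf.prob (random_graph n (p n)) {G\<^sub>2. \<not> can_be_packed (G\<^sub>1 n) G\<^sub>2})
      \<in> O(\<lambda>n. real n powr (- K))"
proof -
  define g where "g = min \<gamma> 1"
  \<comment> \<open>Replacing \<open>\<gamma>\<close> by \<open>g\<close> only weakens the bound on \<open>q\<close> and keeps \<open>1 - g\<close> nonnegative.\<close>
  have g: "0 < g" "g \<le> 1" "g \<le> \<gamma>" using assms by (auto simp: g_def)
  define c where "c = 2 * (16 / g + 2)"
  have c: "c > 0" using g by (auto simp: c_def intro!: add_pos_pos divide_pos_pos)
  have "(\<lambda>n. measure_pmf.prob (random_graph n (p n)) {G\<^sub>2. \<not> can_be_packed (G\<^sub>1 n) G\<^sub>2})
      \<in> O(\<lambda>n. real n powr (- K))"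
    if H: "\<forall>n\<ge>2. p n > 0 \<and> q n > 0
        \<and> p n \<le> 1 - \<delta>
        \<and> q n \<le> real n powr (- \<gamma>)
        \<and> p n * q n * real n \<le> \<delta> * g / 16 * ln (real n)
        \<and> simple_graph (G\<^sub>1 n) \<and> graph_order (G\<^sub>1 n) = n
        \<and> real (max_degree (G\<^sub>1 n)) \<le> q n * real n"
    for p q :: "nat \<Rightarrow> real" and G\<^sub>1 :: "nat \<Rightarrow> 'a ugraph"
  proof (rule landau_o.big_trans)
    have "eventually (\<lambda>n::nat. 20 * real n powr (1 - 3 * g / 8) \<le> real n) at_top"
      using g by real_asymp
    moreover have "eventually (\<lambda>n::nat. 2 * real n powr (g / 8) + 1 \<le> real n) at_top"
      using g by real_asymp
    moreover have "eventually (\<lambda>n::nat. real n \<ge> 10) at_top" by real_asymp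
    ultimately have "eventually (\<lambda>n. measure_pmf.prob (random_graph n (p n)) {G\<^sub>2. \<not> can_be_packed (G\<^sub>1 n) G\<^sub>2}
        \<le> real n ^ 4 * exp (- (real n powr (g / 16) / c))) at_top"
    proof eventually_elim
      case (elim n)
      hence n: "n \<ge> 2" "real n \<ge> 1" by auto
      note Hn = H[rule_format, OF n(1)]
      have "q n * real n \<le> real n powr (- g) * real n"
        using Hn g n by (intro mult_right_mono order.trans[OF _ powr_mono[of "- \<gamma>" "- g"]]) auto
      also have "\<dots> = real n powr (1 - g)"
        using n by (simp add: powr_diff powr_minus field_simps)
      finally have D: "real (max_degree (G\<^sub>1 n)) \<le> real n powr (1 - g)" using Hn by linarith
      have "p n * max_degree (G\<^sub>1 n) \<le> p n * (q n * real n)"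
        using Hn by (intro mult_left_mono) auto
      also have "\<dots> \<le> \<delta> * g / 16 * ln (real n)" using Hn by (simp add: mult.assoc)
      finally have pD: "p n * max_degree (G\<^sub>1 n) \<le> \<delta> * g / 16 * ln (real n)" .
      show ?case
        unfolding c_def using Hn elim
        by (intro prob_cannot_pack_le_powr[OF g(1,2) assms(3) _ _ _ _ D pD]) auto
    qed
    thus "(\<lambda>n. measure_pmf.prob (random_graph n (p n)) {G\<^sub>2. \<not> can_be_packed (G\<^sub>1 n) G\<^sub>2})
      \<in> O(\<lambda>n. real n ^ 4 * exp (- (real n powr (g / 16) / c)))"
      by (intro landau_o.big_mono) (auto elim: eventually_mono)
    show "(\<lambda>n. real n ^ 4 * exp (- (real n powr (g / 16) / c))) \<in> O(\<lambda>n. real n powr (- K))"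
      using g c by real_asymp
  qed
  moreover have "\<delta> * g / 16 > 0" using assms g by simp
  ultimately show ?thesis by blast
qed

end
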